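(* Let $H$ be the group presented by $$H=\langle\, a,t,u \mid a^2,\ [t,u],\ a^{-u}a^t;\ \ [a,a^{t^i}]\ \text{ for all } i\in\mathbb{Z} \,\rangle .$$ Then $H$ has unbounded dead-end depth with respect to the finite generating set $$\mathcal{C}=\{\,a,t,u,at,ta,ata,au,ua,aua\,\},$$ but the dead-end depth of every element of $H$ is at most $2$ with respect to the finite generating set $$\mathcal{D}=\mathcal{C}\cup\{\,tu,atu,tau,tua,atau,atua,taua,ataua,\ ut^{-1},aut^{-1},tat^{-1},t^{-1}at,atat^{-1},at^{-1}at\,\}.$$
   Context: Notation: $[a,b]=a^{-1}b^{-1}ab$, $a^b=b^{-1}ab$, $a^{-b}=b^{-1}a^{-1}b$. For a group $G$ with finite generating set $\mathcal{S}$, let $d_{\mathcal{S}}$ be the associated word metric ($d_{\mathcal{S}}(g,h)$ is the length of a shortest word in $\mathcal{S}^{\pm1}$ representing $g^{-1}h$). The dead-end depth (or depth) of $g\in G$ with respect to $\mathcal{S}$ is the distance, in $d_{\mathcal{S}}$, from $g$ to the complement in $G$ of the closed ball of radius $d_{\mathcal{S}}(1,g)$ centered at $1$; i.e. $\min\{d_{\mathcal{S}}(g,h) : d_{\mathcal{S}}(1,h)>d_{\mathcal{S}}(1,g)\}$, and it is $\infty$ if that ball is all of $G$. Depth is unbounded with respect to $\mathcal{S}$ if for every $N$ there is an element of $G$ of depth greater than $N$. *)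

theory Defs
  imports "HOL-Algebra.Generated_Groups" "HOL-Library.Extended_Nat"
begin

section \<open>Group presentations\<close>

text \<open>The letter \<open>(x, True)\<close> stands for the generator \<open>x\<close>, and \<open>(x, False)\<close> for its formal inverse.\<close>

type_synonym 'x word = "('x \<times> bool) list"

definition winv :: "'x word \<Rightarrow> 'x word" where
  "winv w = rev (map (\<lambda>(x, b). (x, \<not> b)) w)"

definition wpow :: "'x word \<Rightarrow> int \<Rightarrow> 'x word" where
  "wpow w i = concat (replicate (nat \<bar>i\<bar>) (if i \<ge> 0 then w else winv w))"

text \<open>Conventions: \<open>v\<^sup>w = w\<inverse> v w\<close> and \<open>[v, w] = v\<inverse> w\<inverse> v w\<close>.\<close>

definition wconj :: "'x word \<Rightarrow> 'x word \<Rightarrow> 'x word" where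
  "wconj v w = winv w @ v @ w"

definition wcomm :: "'x word \<Rightarrow> 'x word \<Rightarrow> 'x word" where
  "wcomm v w = winv v @ winv w @ v @ w"

inductive pres_eq :: "'x word set \<Rightarrow> 'x word \<Rightarrow> 'x word \<Rightarrow> bool" for R where
  refl: "pres_eq R w w"
| sym: "pres_eq R v w \<Longrightarrow> pres_eq R w v"
| trans: "pres_eq R v w \<Longrightarrow> pres_eq R w z \<Longrightarrow> pres_eq R v z"
| cancel: "pres_eq R (v @ [(x, b), (x, \<not> b)] @ w) (v @ w)"
| relator: "r \<in> R \<Longrightarrow> pres_eq R (v @ r @ w) (v @ w)"

definition pres_rel :: "'x word set \<Rightarrow> ('x word \<times> 'x word) set" where
  "pres_rel R = {(v, w). pres_eq R v w}"

definition pres_class :: "'x word set \<Rightarrow> 'x word \<Rightarrow> 'x word set" where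
  "pres_class R w = pres_rel R `` {w}"

text \<open>The group presented by all elements of the type \<open>'x\<close> as generators and the relators \<open>R\<close>.\<close>

definition presented_group :: "'x word set \<Rightarrow> 'x word set monoid" where
  "presented_group R =
     \<lparr> carrier = UNIV // pres_rel R,
       monoid.mult = (\<lambda>X Y. \<Union>v\<in>X. \<Union>w\<in>Y. pres_class R (v @ w)),
       one = pres_class R [] \<rparr>"

lemma equiv_pres_rel: "equiv UNIV (pres_rel R)"
proof (rule equivI)
  show "refl (pres_rel R)"
    by (simp add: pres_rel_def refl_on_def pres_eq.refl)
  show "sym (pres_rel R)"
    by (rule symI) (simp add: pres_rel_def pres_eq.sym)
  show "trans (pres_rel R)"
    by (rule transI) (simp add: pres_rel_def, erule (1) pres_eq.trans)
qed simp_all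

lemma pres_class_eq_iff: "pres_class R v = pres_class R w \<longleftrightarrow> pres_eq R v w"
  unfolding pres_class_def
  using eq_equiv_class_iff[OF equiv_pres_rel, of v w R] by (simp add: pres_rel_def)

lemma pres_eq_context: "pres_eq R v w \<Longrightarrow> pres_eq R (p @ v @ q) (p @ w @ q)"
proof (induction rule: pres_eq.induct)
  case (refl w)
  show ?case by (rule pres_eq.refl)
next
  case (sym v w)
  then show ?case by (simp only: pres_eq.sym)
next
  case (trans v w z)
  from trans.IH show ?case by (rule pres_eq.trans)
next
  case (cancel v x b w)
  show ?case using pres_eq.cancel[of R "p @ v" x b "w @ q"] by simp
next
  case (relator r v w)
  then show ?case using pres_eq.relator[of r R "p @ v" "w @ q"] by simp
qed

lemma pres_eq_append:
  assumes "pres_eq R v v'" "pres_eq R w w'"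
  shows "pres_eq R (v @ w) (v' @ w')"
  using pres_eq_context[OF assms(1), of "[]" w] pres_eq_context[OF assms(2), of v' "[]"]
  by simp (rule pres_eq.trans)

lemma pres_eq_winv: "pres_eq R (winv w @ w) []"
proof (induction w)
  case Nil
  show ?case by (simp add: winv_def pres_eq.refl)
next
  case (Cons l w)
  obtain x b where l: "l = (x, b)" by (cases l)
  have "pres_eq R (winv (l # w) @ (l # w)) (winv w @ w)"
    using pres_eq.cancel[of R "winv w" x "\<not> b" w] by (simp add: winv_def l)
  then show ?case using Cons by (rule pres_eq.trans)
qed

lemma presented_group_mult:
  "pres_class R v \<otimes>\<^bsub>presented_group R\<^esub> pres_class R w = pres_class R (v @ w)"
proof -
  have mem: "x \<in> pres_class R y \<longleftrightarrow> pres_eq R y x" for x y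
    by (simp add: pres_class_def pres_rel_def)
  have "pres_class R (v' @ w') = pres_class R (v @ w)"
    if "v' \<in> pres_class R v" "w' \<in> pres_class R w" for v' w'
    using that pres_eq_append[of R v v' w w', THEN pres_eq.sym]
    by (simp only: mem pres_class_eq_iff)
  then have "(\<Union>v'\<in>pres_class R v. \<Union>w'\<in>pres_class R w. pres_class R (v' @ w')) =
      (\<Union>v'\<in>pres_class R v. \<Union>w'\<in>pres_class R w. pres_class R (v @ w))"
    by (intro SUP_cong HOL.refl)
  moreover have "pres_class R v \<noteq> {}" "pres_class R w \<noteq> {}"
    using mem[of v v] mem[of w w] pres_eq.refl by blast+
  ultimately show ?thesis by (simp add: presented_group_def)
qed

lemma presented_group_carrier: "carrier (presented_group R) = range (pres_class R)"
  by (auto simp: presented_group_def quotient_def pres_class_def)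

lemma presented_group_one: "\<one>\<^bsub>presented_group R\<^esub> = pres_class R []"
  by (simp add: presented_group_def)

lemma group_presented_group: "group (presented_group R)" (is "group ?G")
proof (rule groupI)
  show "\<one>\<^bsub>?G\<^esub> \<in> carrier ?G"
    by (simp add: presented_group_carrier presented_group_one)
next
  fix X Y assume "X \<in> carrier ?G" "Y \<in> carrier ?G"
  then obtain v w where "X = pres_class R v" "Y = pres_class R w"
    unfolding presented_group_carrier by blast
  then show "X \<otimes>\<^bsub>?G\<^esub> Y \<in> carrier ?G"
    by (simp add: presented_group_mult presented_group_carrier)
next
  fix X Y Z assume "X \<in> carrier ?G" "Y \<in> carrier ?G" "Z \<in> carrier ?G"
  then obtain v w z where "X = pres_class R v" "Y = pres_class R w" "Z = pres_class R z"
    unfolding presented_group_carrier by blast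
  then show "X \<otimes>\<^bsub>?G\<^esub> Y \<otimes>\<^bsub>?G\<^esub> Z = X \<otimes>\<^bsub>?G\<^esub> (Y \<otimes>\<^bsub>?G\<^esub> Z)"
    by (simp add: presented_group_mult)
next
  fix X assume "X \<in> carrier ?G"
  then obtain w where X: "X = pres_class R w"
    unfolding presented_group_carrier by blast
  then show "\<one>\<^bsub>?G\<^esub> \<otimes>\<^bsub>?G\<^esub> X = X"
    by (simp add: presented_group_mult presented_group_one)
  have "pres_class R (winv w) \<otimes>\<^bsub>?G\<^esub> X = \<one>\<^bsub>?G\<^esub>"
    unfolding X presented_group_mult presented_group_one pres_class_eq_iff
    by (rule pres_eq_winv)
  then show "\<exists>Y\<in>carrier ?G. Y \<otimes>\<^bsub>?G\<^esub> X = \<one>\<^bsub>?G\<^esub>"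
    unfolding presented_group_carrier by blast
qed

section \<open>Word metric and dead-end depth\<close>

text \<open>\<open>word_length G S g\<close> is only meaningful if \<open>S\<close> generates \<open>G\<close> (otherwise the set under
  \<open>LEAST\<close> may be empty).\<close>

definition word_length :: "('g, 'm) monoid_scheme \<Rightarrow> 'g set \<Rightarrow> 'g \<Rightarrow> nat" where
  "word_length G S g =
     (LEAST n. \<exists>ws. length ws = n \<and> set ws \<subseteq> S \<union> m_inv G ` S \<and>
                    foldr (\<otimes>\<^bsub>G\<^esub>) ws \<one>\<^bsub>G\<^esub> = g)"

definition word_dist :: "('g, 'm) monoid_scheme \<Rightarrow> 'g set \<Rightarrow> 'g \<Rightarrow> 'g \<Rightarrow> nat" where
  "word_dist G S g h = word_length G S (inv\<^bsub>G\<^esub> g \<otimes>\<^bsub>G\<^esub> h)"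

text \<open>The infimum of the empty set in \<^typ>\<open>enat\<close> is \<open>\<infinity>\<close>.\<close>

definition dead_end_depth :: "('g, 'm) monoid_scheme \<Rightarrow> 'g set \<Rightarrow> 'g \<Rightarrow> enat" where
  "dead_end_depth G S g =
     (INF h \<in> {h \<in> carrier G. word_dist G S \<one>\<^bsub>G\<^esub> h > word_dist G S \<one>\<^bsub>G\<^esub> g}.
        enat (word_dist G S g h))"

definition unbounded_depth :: "('g, 'm) monoid_scheme \<Rightarrow> 'g set \<Rightarrow> bool" where
  "unbounded_depth G S \<longleftrightarrow> (\<forall>N::nat. \<exists>g\<in>carrier G. dead_end_depth G S g > enat N)"

section \<open>The group and its generating sets\<close>

datatype gen = A | T | U

definition wa :: "gen word" where "wa = [(A, True)]"
definition wt :: "gen word" where "wt = [(T, True)]"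
definition wu :: "gen word" where "wu = [(U, True)]"

definition H_relators :: "gen word set" where
  "H_relators =
     {wpow wa 2, wcomm wt wu, wconj (winv wa) wu @ wconj wa wt}
     \<union> range (\<lambda>i::int. wcomm wa (wconj wa (wpow wt i)))"

definition H :: "gen word set monoid" where
  "H = presented_group H_relators"

definition C_gens :: "gen word set set" where
  "C_gens = pres_class H_relators `
     {wa, wt, wu,
      wa @ wt, wt @ wa, wa @ wt @ wa,
      wa @ wu, wu @ wa, wa @ wu @ wa}"

definition D_gens :: "gen word set set" where
  "D_gens = C_gens \<union> pres_class H_relators `
     {wt @ wu, wa @ wt @ wu, wt @ wa @ wu,
      wt @ wu @ wa, wa @ wt @ wa @ wu, wa @ wt @ wu @ wa,
      wt @ wa @ wu @ wa, wa @ wt @ wa @ wu @ wa, wu @ winv wt,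
      wa @ wu @ winv wt, wt @ wa @ winv wt, winv wt @ wa @ wt,
      wa @ wt @ wa @ winv wt, wa @ winv wt @ wa @ wt}"

end

theory Submission
  imports Defs
begin

text \<open>
  The group is a lamplighter group times an infinite cyclic group generated by \<open>z = u t\<inverse>\<close>: an
  element is a finite set of lit lamps together with the exponent sums \<open>x\<close> of \<open>t\<close> and \<open>y\<close> of \<open>u\<close>, and
  the lamplighter stands at \<open>x + y\<close>.

  With respect to \<open>C\<close> every step moves the lamplighter by one place, toggling lamps at both ends
  for free, so word length is bounded below by the length of a tour of the lit lamps. The element
  with lamps lit at \<open>\<plusminus>n\<close> and \<open>x = y = 0\<close> needs a tour of length \<open>4 n\<close>, while every element within
  distance less than \<open>n\<close> of it still has its lamps and exponents in range and is reached by a tour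
  of length at most \<open>4 n\<close>.

  With respect to \<open>D\<close> every step satisfies ``distance travelled plus change of \<open>\<bar>x - y\<bar>\<close> is at
  most \<open>2\<close>'', and this bound is sharp: the word length is half the sum of the tour length and
  \<open>\<bar>x - y\<bar>\<close>, up to an error of \<open>1\<close>. Multiplying by the central element \<open>z\<^sup>2\<close> or its inverse
  increases \<open>\<bar>x - y\<bar>\<close> by \<open>4\<close>, hence this lower bound by \<open>2\<close>, which outweighs the error.
\<close>

section \<open>Word length by products of symmetrised generators\<close>

fun products :: "('g, 'm) monoid_scheme \<Rightarrow> 'g set \<Rightarrow> nat \<Rightarrow> 'g set" where
  "products G X 0 = {\<one>\<^bsub>G\<^esub>}"
| "products G X (Suc n) = {s \<otimes>\<^bsub>G\<^esub> g | s g. s \<in> X \<and> g \<in> products G X n}"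

text \<open>The identity is included so that a product of exactly \<open>n\<close> factors stands
  for a word of length at most \<open>n\<close>, and \<open>products\<close> grows with
  \<open>n\<close>.\<close>

definition sym_set :: "('g, 'm) monoid_scheme \<Rightarrow> 'g set \<Rightarrow> 'g set" where
  "sym_set G S = insert \<one>\<^bsub>G\<^esub> (S \<union> m_inv G ` S)"

lemma products_mono_set: "X \<subseteq> Y \<Longrightarrow> products G X n \<subseteq> products G Y n"
  by (induction n) auto

context group
begin

lemma sym_set_closed: "S \<subseteq> carrier G \<Longrightarrow> sym_set G S \<subseteq> carrier G"
  by (auto simp: sym_set_def)

lemma products_closed: "X \<subseteq> carrier G \<Longrightarrow> products G X n \<subseteq> carrier G"
  by (induction n) auto

lemma products_1: "X \<subseteq> carrier G \<Longrightarrow> s \<in> X \<Longrightarrow> s \<in> products G X 1"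
  by force

lemma products_mult:
  assumes X: "X \<subseteq> carrier G" and h: "h \<in> products G X n"
  shows "g \<in> products G X m \<Longrightarrow> g \<otimes> h \<in> products G X (m + n)"
proof (induction m arbitrary: g)
  case 0
  have "h \<in> carrier G" using products_closed[OF X] h by blast
  with 0 h show ?case by simp
next
  case (Suc m)
  obtain s g' where g: "g = s \<otimes> g'" "s \<in> X" "g' \<in> products G X m" using Suc.prems by auto
  have "s \<in> carrier G" "g' \<in> carrier G" "h \<in> carrier G"
    using products_closed[OF X] g h X by blast+
  then have "g \<otimes> h = s \<otimes> (g' \<otimes> h)" using g by (simp add: m_assoc)
  with g Suc.IH show ?case by auto
qed

lemma products_mono:
  assumes X: "X \<subseteq> carrier G" and "\<one> \<in> X" and "m \<le> n"
  shows "products G X m \<subseteq> products G X n"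
proof -
  have "products G X k \<subseteq> products G X (Suc k)" for k
  proof
    fix g assume g: "g \<in> products G X k"
    then have "g \<in> carrier G" using products_closed[OF X] by blast
    then have "g = \<one> \<otimes> g" by simp
    with g assms(2) show "g \<in> products G X (Suc k)" by auto
  qed
  then show ?thesis by (rule lift_Suc_mono_le[OF _ \<open>m \<le> n\<close>])
qed

text \<open>Dropping identity factors turns a product into a word that is no longer; conversely a
  short word is padded with identities.\<close>

lemma products_sym_set_iff:
  assumes S: "S \<subseteq> carrier G"
  shows "g \<in> products G (sym_set G S) n \<longleftrightarrow>
    (\<exists>ws. length ws \<le> n \<and> set ws \<subseteq> S \<union> m_inv G ` S \<and> foldr (\<otimes>) ws \<one> = g)"
    (is "_ \<longleftrightarrow> ?P n g")
proof
  show "g \<in> products G (sym_set G S) n \<Longrightarrow> ?P n g"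
  proof (induction n arbitrary: g)
    case 0
    then show ?case by simp
  next
    case (Suc n)
    then obtain s g' where g: "g = s \<otimes> g'" "s \<in> sym_set G S" "g' \<in> products G (sym_set G S) n"
      by auto
    from Suc.IH[OF g(3)] obtain ws where
      ws: "length ws \<le> n" "set ws \<subseteq> S \<union> m_inv G ` S" "foldr (\<otimes>) ws \<one> = g'" by blast
    have g': "g' \<in> carrier G" using products_closed[OF sym_set_closed[OF S]] g by blast
    show ?case
    proof (cases "s = \<one>")
      case True
      then show ?thesis using ws g g' by (intro exI[of _ ws]) simp
    next
      case False
      then show ?thesis using ws g by (intro exI[of _ "s # ws"]) (auto simp: sym_set_def)
    qed
  qed
next
  assume "?P n g"
  then obtain ws where
    ws: "length ws \<le> n" "set ws \<subseteq> S \<union> m_inv G ` S" "foldr (\<otimes>) ws \<one> = g" by blast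
  have "set ws \<subseteq> S \<union> m_inv G ` S \<Longrightarrow> foldr (\<otimes>) ws \<one> \<in> products G (sym_set G S) (length ws)"
    for ws
    by (induction ws) (auto simp: sym_set_def)
  with ws have "g \<in> products G (sym_set G S) (length ws)" by blast
  then show "g \<in> products G (sym_set G S) n"
    using products_mono[OF sym_set_closed[OF S] _ ws(1)] by (auto simp: sym_set_def)
qed

text \<open>All later length estimates pass through this equivalence. The assumption
  \<open>ex\<close> ensures that the set under \<open>LEAST\<close> is nonempty, so that the minimum
  is attained.\<close>

lemma word_length_le_iff:
  assumes S: "S \<subseteq> carrier G" and ex: "\<exists>k. g \<in> products G (sym_set G S) k"
  shows "word_length G S g \<le> n \<longleftrightarrow> g \<in> products G (sym_set G S) n"
proof -
  let ?P = "\<lambda>n. \<exists>ws. length ws = n \<and> set ws \<subseteq> S \<union> m_inv G ` S \<and> foldr (\<otimes>) ws \<one> = g"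
  have iff: "g \<in> products G (sym_set G S) n \<longleftrightarrow> (\<exists>k\<le>n. ?P k)" for n
    unfolding products_sym_set_iff[OF S] by blast
  obtain k where "?P k" using ex unfolding iff by blast
  then have "?P (word_length G S g)"
    unfolding word_length_def by (rule LeastI[of ?P])
  then show ?thesis
    unfolding iff
  proof (intro iffI)
    assume "\<exists>k\<le>n. ?P k"
    then obtain k where k: "k \<le> n" "?P k" by blast
    have "word_length G S g \<le> k" unfolding word_length_def by (rule Least_le[of ?P, OF k(2)])
    with k(1) show "word_length G S g \<le> n" by simp
  qed blast
qed

lemma word_dist_one: "g \<in> carrier G \<Longrightarrow> word_dist G S \<one> g = word_length G S g"
  by (simp add: word_dist_def)

end

section \<open>Invariance of length and depth under isomorphism\<close>

lemma word_length_iso: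
  assumes f: "f \<in> iso G G'" and G: "group G" "group G'" and S: "S \<subseteq> carrier G"
    and g: "g \<in> carrier G"
  shows "word_length G' (f ` S) (f g) = word_length G S g"
proof -
  interpret G: group G by (rule G)
  interpret G': group G' by (rule G)
  interpret group_hom G G' f
    using f G by (simp add: group_hom_def group_hom_axioms_def iso_def)
  have inj: "inj_on f (carrier G)" using f by (simp add: iso_def bij_betw_def)
  let ?X = "S \<union> m_inv G ` S" and ?Y = "f ` S \<union> m_inv G' ` f ` S"
  have Y: "?Y = f ` ?X" 
  proof -
    have "m_inv G' ` f ` S = f ` m_inv G ` S"
      unfolding image_image using S by (intro image_cong) auto
    then show ?thesis by (simp only: image_Un)
  qed
  have X: "?X \<subseteq> carrier G" using S by auto
  have cl: "foldr (\<otimes>\<^bsub>G\<^esub>) ws \<one>\<^bsub>G\<^esub> \<in> carrier G" if "set ws \<subseteq> ?X" for ws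
    using that X by (induction ws) auto
  have fold: "foldr (\<otimes>\<^bsub>G'\<^esub>) (map f ws) \<one>\<^bsub>G'\<^esub> = f (foldr (\<otimes>\<^bsub>G\<^esub>) ws \<one>\<^bsub>G\<^esub>)"
    if "set ws \<subseteq> ?X" for ws
    using that
  proof (induction ws)
    case (Cons s ws)
    then have "s \<in> carrier G" using X by auto
    then show ?case using Cons cl[of ws] by simp
  qed simp
  have "(\<exists>ws. length ws = n \<and> set ws \<subseteq> ?Y \<and> foldr (\<otimes>\<^bsub>G'\<^esub>) ws \<one>\<^bsub>G'\<^esub> = f g) \<longleftrightarrow>
        (\<exists>ws. length ws = n \<and> set ws \<subseteq> ?X \<and> foldr (\<otimes>\<^bsub>G\<^esub>) ws \<one>\<^bsub>G\<^esub> = g)" (is "?L \<longleftrightarrow> ?R") for n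
  proof
    assume ?L
    then obtain vs where vs: "length vs = n" "set vs \<subseteq> f ` ?X"
      "foldr (\<otimes>\<^bsub>G'\<^esub>) vs \<one>\<^bsub>G'\<^esub> = f g" unfolding Y by blast
    from vs(2) have "vs \<in> lists (f ` ?X)" by auto
    then have "vs \<in> map f ` lists ?X" by (simp only: lists_image)
    then obtain ws where ws: "vs = map f ws" "set ws \<subseteq> ?X" by (auto simp: lists_eq_set)
    with vs fold[of ws] have "f (foldr (\<otimes>\<^bsub>G\<^esub>) ws \<one>\<^bsub>G\<^esub>) = f g" by simp
    then have "foldr (\<otimes>\<^bsub>G\<^esub>) ws \<one>\<^bsub>G\<^esub> = g" using inj cl[OF ws(2)] g by (meson inj_onD)
    with vs(1) ws show ?R by auto
  next
    assume ?R
    then obtain ws where ws: "length ws = n" "set ws \<subseteq> ?X"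
      "foldr (\<otimes>\<^bsub>G\<^esub>) ws \<one>\<^bsub>G\<^esub> = g" by blast
    then have "length (map f ws) = n \<and> set (map f ws) \<subseteq> ?Y \<and>
        foldr (\<otimes>\<^bsub>G'\<^esub>) (map f ws) \<one>\<^bsub>G'\<^esub> = f g"
      using fold[of ws] unfolding Y by (simp add: image_mono)
    then show ?L by blast
  qed
  then show ?thesis unfolding word_length_def by simp
qed

text \<open>Distances are preserved, and by surjectivity \<open>f\<close> carries the complement of
  the ball onto the complement of the ball.\<close>

lemma dead_end_depth_iso:
  assumes f: "f \<in> iso G G'" and G: "group G" "group G'" and S: "S \<subseteq> carrier G"
    and g: "g \<in> carrier G"
  shows "dead_end_depth G' (f ` S) (f g) = dead_end_depth G S g"
proof -
  interpret G: group G by (rule G)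
  interpret G': group G' by (rule G)
  interpret group_hom G G' f
    using f G by (simp add: group_hom_def group_hom_axioms_def iso_def)
  have surj: "f ` carrier G = carrier G'" using f by (simp add: iso_def bij_betw_def)
  have dist: "word_dist G' (f ` S) (f h) (f k) = word_dist G S h k"
    if "h \<in> carrier G" "k \<in> carrier G" for h k
    using word_length_iso[OF f G S, of "inv\<^bsub>G\<^esub> h \<otimes>\<^bsub>G\<^esub> k"] that by (simp add: word_dist_def)
  have dist1: "word_dist G' (f ` S) \<one>\<^bsub>G'\<^esub> (f k) = word_dist G S \<one>\<^bsub>G\<^esub> k" if "k \<in> carrier G" for k
    using dist[of "\<one>\<^bsub>G\<^esub>" k] that by simp
  have "{h \<in> carrier G'. word_dist G' (f ` S) \<one>\<^bsub>G'\<^esub> h > word_dist G' (f ` S) \<one>\<^bsub>G'\<^esub> (f g)} =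
      f ` {h \<in> carrier G. word_dist G S \<one>\<^bsub>G\<^esub> h > word_dist G S \<one>\<^bsub>G\<^esub> g}"
    unfolding surj[symmetric] using dist1 g by auto
  then show ?thesis
    unfolding dead_end_depth_def image_comp comp_def
    by (simp add: image_image) (rule INF_cong, auto simp: dist g)
qed

section \<open>The lamplighter model\<close>

declare products.simps(2) [simp del]

text \<open>A triple \<open>(F, x, y)\<close> records the set \<open>F\<close> of lit lamps and the exponent sums \<open>x\<close> of \<open>t\<close> and
  \<open>y\<close> of \<open>u\<close>; since \<open>t\<close> and \<open>u\<close> both move the lamplighter one place to the right, its position
  is \<open>x + y\<close>.\<close>

definition lamps :: "(int set \<times> int \<times> int) monoid" where
  "lamps = \<lparr> carrier = {(F, x, y). finite F},
     monoid.mult = (\<lambda>(F, x, y) (G, x', y'). ({i. (i \<in> F) \<noteq> (i - (x + y) \<in> G)}, x + x', y + y')),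
     one = ({}, 0, 0) \<rparr>"

lemma lamps_carrier [simp]: "(F, x, y) \<in> carrier lamps \<longleftrightarrow> finite F"
  and lamps_one: "\<one>\<^bsub>lamps\<^esub> = ({}, 0, 0)"
  and lamps_mult: "(F, x, y) \<otimes>\<^bsub>lamps\<^esub> (G, x', y') =
    ({i. (i \<in> F) \<noteq> (i - (x + y) \<in> G)}, x + x', y + y')"
  by (simp_all add: lamps_def)

lemma finite_shift: "finite G \<Longrightarrow> finite {i::int. i + c \<in> G}"
  using finite_vimageI[of G "\<lambda>i. i + c"] by (simp add: vimage_def inj_def)

lemma group_lamps: "group lamps"
proof (rule groupI)
  fix g h assume "g \<in> carrier lamps" "h \<in> carrier lamps"
  moreover obtain F x y G x' y' where gh: "g = (F, x, y)" "h = (G, x', y')"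
    by (cases g, cases h) auto
  ultimately have "finite (F \<union> {i. i - (x + y) \<in> G})"
    using finite_shift[of G "- (x + y)"] by (simp only: add_uminus_conv_diff) simp
  then have "finite {i. (i \<in> F) \<noteq> (i - (x + y) \<in> G)}" by (rule finite_subset[rotated]) auto
  then show "g \<otimes>\<^bsub>lamps\<^esub> h \<in> carrier lamps" by (simp add: gh lamps_mult)
next
  fix g assume g: "g \<in> carrier lamps"
  obtain F x y where g': "g = (F, x, y)" by (cases g)
  have "({i. i + (x + y) \<in> F}, - x, - y) \<in> carrier lamps"
    using g by (simp add: g' finite_shift)
  moreover have "({i. i + (x + y) \<in> F}, - x, - y) \<otimes>\<^bsub>lamps\<^esub> g = \<one>\<^bsub>lamps\<^esub>"
    by (simp add: g' lamps_mult lamps_one algebra_simps)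
  ultimately show "\<exists>h\<in>carrier lamps. h \<otimes>\<^bsub>lamps\<^esub> g = \<one>\<^bsub>lamps\<^esub>" by blast
qed (auto simp: lamps_mult lamps_one diff_diff_eq add.assoc add.left_commute)

interpretation lamps: group lamps by (rule group_lamps)

lemma lamps_inv:
  assumes "finite F"
  shows "inv\<^bsub>lamps\<^esub> (F, x, y) = ({i. i + (x + y) \<in> F}, - x, - y)"
  by (rule lamps.inv_equality) (use assms in \<open>simp_all add: lamps_mult lamps_one finite_shift algebra_simps\<close>)

text \<open>The places visited on a straight walk from \<open>0\<close> to \<open>p\<close>,
  whichever side \<open>p\<close> lies on.\<close>

definition seg :: "int \<Rightarrow> int set" where "seg p = {min 0 p..max 0 p}"

text \<open>The single steps available with the symmetrised generating sets (and the identity). In the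
  second part of \<open>D_steps\<close> the lamplighter toggles a neighbouring lamp without moving; this is what
  lets it turn round at either parity at the cost of two places per step.\<close>

definition C_steps :: "(int set \<times> int \<times> int) set" where
  "C_steps = {(F, x, y). \<bar>x\<bar> + \<bar>y\<bar> \<le> 1 \<and> F \<subseteq> seg (x + y)}"

definition D_steps :: "(int set \<times> int \<times> int) set" where
  "D_steps = {(F, x, y). \<bar>x\<bar> \<le> 1 \<and> \<bar>y\<bar> \<le> 1 \<and> F \<subseteq> seg (x + y)} \<union>
     {(F, x, y). x = 0 \<and> y = 0 \<and> (F \<subseteq> {0, 1} \<or> F \<subseteq> {- 1, 0})}"

lemma D_steps_closed: "D_steps \<subseteq> carrier lamps"
  by (auto simp: D_steps_def seg_def dest: finite_subset)

lemma C_steps_subset: "C_steps \<subseteq> D_steps"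
  by (auto simp: C_steps_def D_steps_def)

lemma C_steps_closed: "C_steps \<subseteq> carrier lamps"
  using C_steps_subset D_steps_closed by blast

lemma one_in_C_steps: "\<one>\<^bsub>lamps\<^esub> \<in> C_steps"
  by (simp add: C_steps_def lamps_one)

lemma one_in_D_steps: "\<one>\<^bsub>lamps\<^esub> \<in> D_steps"
  using one_in_C_steps C_steps_subset by blast

text \<open>The components of the product appear as separate equations, so that the rule applies to
  a triple in any form and leaves the set identity and the arithmetic as side goals.\<close>

lemma lamps_products_mult:
  assumes "X \<subseteq> carrier lamps" "(F, x, y) \<in> products lamps X m" "(G, x', y') \<in> products lamps X n"
    and "K = {i. (i \<in> F) \<noteq> (i - (x + y) \<in> G)}" "x'' = x + x'" "y'' = y + y'" "k = m + n"
  shows "(K, x'', y'') \<in> products lamps X k"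
  using lamps.products_mult[OF assms(1,3,2)] assms(4-) by (simp add: lamps_mult)

section \<open>Symmetries of the model\<close>

lemma products_hom_image:
  assumes "h \<one>\<^bsub>G\<^esub> = \<one>\<^bsub>G\<^esub>" "\<And>g g'. h (g \<otimes>\<^bsub>G\<^esub> g') = h g \<otimes>\<^bsub>G\<^esub> h g'" "h ` X \<subseteq> X"
  shows "g \<in> products G X n \<Longrightarrow> h g \<in> products G X n"
proof (induction n arbitrary: g)
  case 0
  then show ?case using assms(1) by simp
next
  case (Suc n)
  then obtain s g' where "g = s \<otimes>\<^bsub>G\<^esub> g'" "s \<in> X" "g' \<in> products G X n"
    by (auto simp: products.simps(2))
  then have "h g = h s \<otimes>\<^bsub>G\<^esub> h g'" "h s \<in> X" "h g' \<in> products G X n"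
    using assms(2,3) Suc.IH by auto
  then show ?case by (auto simp: products.simps(2))
qed

text \<open>Reflecting the line at the origin is an automorphism; it reduces walks to the left to
  walks to the right.\<close>

lemma products_mirror:
  assumes "\<And>F x y. (F, x, y) \<in> X \<Longrightarrow> ({i. - i \<in> F}, - x, - y) \<in> X"
    and "(F, x, y) \<in> products lamps X n"
  shows "({i. - i \<in> F}, - x, - y) \<in> products lamps X n"
proof -
  let ?h = "\<lambda>(F, x, y). ({i::int. - i \<in> F}, - x :: int, - y :: int)"
  \<comment> \<open>Brings the index on the left-hand side into the shape produced by the mirrored
    factors.\<close>
  have minus: "- i - (a + b) = - (i - (- a + - b))" for i a b :: int by simp
  have hom: "?h (g \<otimes>\<^bsub>lamps\<^esub> g') = ?h g \<otimes>\<^bsub>lamps\<^esub> ?h g'" for g g'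
    by (cases g, cases g') (simp only: lamps_mult prod.case mem_Collect_eq minus, simp)
  have "?h (F, x, y) \<in> products lamps X n"
    by (rule products_hom_image[OF _ hom _ assms(2)]) (use assms(1) in \<open>auto simp: lamps_one\<close>)
  then show ?thesis by simp
qed

text \<open>Exchanging the roles of \<open>t\<close> and \<open>u\<close> keeps the position
  \<open>x + y\<close>, so it respects the multiplication.\<close>

lemma products_swap:
  assumes "\<And>F x y. (F, x, y) \<in> X \<Longrightarrow> (F, y, x) \<in> X" and "(F, x, y) \<in> products lamps X n"
  shows "(F, y, x) \<in> products lamps X n"
proof -
  let ?h = "\<lambda>(F :: int set, x :: int, y :: int). (F, y, x)"
  have "?h (F, x, y) \<in> products lamps X n"
    by (rule products_hom_image[OF _ _ _ assms(2)])
      (use assms(1) in \<open>auto simp: lamps_one lamps_mult algebra_simps\<close>)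
  then show ?thesis by simp
qed

lemma C_steps_mirror: "(F, x, y) \<in> C_steps \<Longrightarrow> ({i. - i \<in> F}, - x, - y) \<in> C_steps"
  by (force simp: C_steps_def seg_def subset_iff)

lemma C_steps_swap: "(F, x, y) \<in> C_steps \<Longrightarrow> (F, y, x) \<in> C_steps"
  by (auto simp: C_steps_def add.commute)

lemma D_steps_mirror: "(F, x, y) \<in> D_steps \<Longrightarrow> ({i. - i \<in> F}, - x, - y) \<in> D_steps"
  by (force simp: D_steps_def seg_def subset_iff)

lemma D_steps_swap: "(F, x, y) \<in> D_steps \<Longrightarrow> (F, y, x) \<in> D_steps"
  by (auto simp: D_steps_def add.commute)

section \<open>Short words over the first generating set\<close>

text \<open>One pass to the right toggles each lamp on arrival at its place, and every single step
  may be \<open>t\<close> or \<open>u\<close>, so the lamps and the split of the exponents can be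
  chosen freely.\<close>

lemma C_leg:
  "S \<subseteq> {1..int k} \<Longrightarrow> 0 \<le> y \<Longrightarrow> y \<le> int k \<Longrightarrow> (S, int k - y, y) \<in> products lamps C_steps k"
proof (induction k arbitrary: S y)
  case 0
  then show ?case by (simp add: lamps_one)
next
  case (Suc k)
  \<comment> \<open>The first step is \<open>t\<close> unless \<open>y = Suc k\<close>, when every
    step has to be \<open>u\<close>.\<close>
  define e where "e = (if y \<le> int k then 0 else 1 :: int)"
  have "({i. 1 \<le> i \<and> i + 1 \<in> S}, int k - (y - e), y - e) \<in> products lamps C_steps k"
    by (rule Suc.IH) (use Suc.prems in \<open>auto simp: e_def\<close>)
  note ih = this
  have step: "(S \<inter> {1}, 1 - e, e) \<in> products lamps C_steps 1"
    by (rule lamps.products_1[OF C_steps_closed]) (auto simp: C_steps_def e_def seg_def)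
  have "S = {i. (i \<in> S \<inter> {1}) \<noteq> (i - (1 - e + e) \<in> {i. 1 \<le> i \<and> i + 1 \<in> S})}"
    using Suc.prems(1) by force
  then show ?case by (rule lamps_products_mult[OF C_steps_closed step ih]) simp_all
qed

lemma C_leg_left:
  assumes "S \<subseteq> {- int k..- 1}"
  shows "(S, - int k, 0) \<in> products lamps C_steps k"
proof -
  have "({i. - i \<in> S}, int k - 0, 0) \<in> products lamps C_steps k"
    by (rule C_leg) (use assms in force)+
  from products_mirror[OF C_steps_mirror this] show ?thesis by simp
qed

text \<open>The walk goes from \<open>0\<close> to \<open>- n\<close>, back to \<open>0\<close>, on
  to \<open>n\<close>, and finally back to \<open>x + y\<close>. All \<open>y\<close> letters
  \<open>u\<close> are spent on the third leg; the other legs use only \<open>t\<close> and its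
  inverse.\<close>

lemma C_steps_upper_aux:
  assumes S: "S \<subseteq> {- int n..int n}" and n: "n \<ge> 1" and "x + y \<ge> 0" "y \<ge> 0" "\<bar>x\<bar> + \<bar>y\<bar> \<le> int n"
  shows "(S, x, y) \<in> products lamps C_steps (4 * n)"
proof -
  let ?P = "products lamps C_steps"
  have 1: "(S \<inter> {- int n..- 1}, - int n, 0) \<in> ?P n" by (rule C_leg_left) auto
  \<comment> \<open>Seen from \<open>- n\<close>, the origin is place \<open>n\<close>: lamp
    \<open>0\<close> is toggled on arrival there, which needs \<open>n \<ge> 1\<close>.\<close>
  have 2: "({i. i = int n \<and> 0 \<in> S}, int n - 0, 0) \<in> ?P n"
    by (rule C_leg) (use assms in auto)
  have 3: "(S \<inter> {1..int n}, int n - y, y) \<in> ?P n"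
    by (rule C_leg) (use assms in auto)
  have 4: "({}, - int (nat (int n - (x + y))), 0) \<in> ?P (nat (int n - (x + y)))"
    by (rule C_leg_left) auto
  have eq2: "S \<inter> {- int n..0} = {i. (i \<in> S \<inter> {- int n..- 1}) \<noteq>
      (i - (- int n + 0) \<in> {i. i = int n \<and> 0 \<in> S})}"
    (is "_ = ?R")
  proof (rule Set.set_eqI)
    fix i show "i \<in> S \<inter> {- int n..0} \<longleftrightarrow> i \<in> ?R" using n by (cases "i = 0") auto
  qed
  have 12: "(S \<inter> {- int n..0}, 0, 0) \<in> ?P (n + n)"
    using eq2 by (rule lamps_products_mult[OF C_steps_closed 1 2]) simp_all
  have eq3: "S = {i. (i \<in> S \<inter> {- int n..0}) \<noteq> (i - (0 + 0) \<in> S \<inter> {1..int n})}"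
    using S by auto
  have 123: "(S, int n - y, y) \<in> ?P (n + n + n)"
    using eq3 by (rule lamps_products_mult[OF C_steps_closed 12 3]) simp_all
  have "(S, x, y) \<in> ?P (n + n + n + nat (int n - (x + y)))"
    by (rule lamps_products_mult[OF C_steps_closed 123 4]) (use assms(5) in simp_all)
  moreover have "n + n + n + nat (int n - (x + y)) \<le> 4 * n" using assms by auto
  ultimately show ?thesis using lamps.products_mono[OF C_steps_closed one_in_C_steps] by blast
qed

text \<open>The mirror gives \<open>x + y \<ge> 0\<close>; then at least one exponent is
  nonnegative, and the swap makes it the second one.\<close>

lemma C_steps_upper:
  assumes S: "S \<subseteq> {- int n..int n}" and n: "n \<ge> 1" and xy: "\<bar>x\<bar> + \<bar>y\<bar> \<le> int n"
  shows "(S, x, y) \<in> products lamps C_steps (4 * n)"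
proof -
  have pos: "(S, x, y) \<in> products lamps C_steps (4 * n)"
    if "S \<subseteq> {- int n..int n}" "x + y \<ge> 0" "\<bar>x\<bar> + \<bar>y\<bar> \<le> int n" for S x y
  proof (cases "y \<ge> 0")
    case True
    then show ?thesis using C_steps_upper_aux n that by simp
  next
    case False
    then have "(S, y, x) \<in> products lamps C_steps (4 * n)"
      using C_steps_upper_aux n that by simp
    then show ?thesis using products_swap C_steps_swap by blast
  qed
  show ?thesis
  proof (cases "x + y \<ge> 0")
    case True
    then show ?thesis using pos assms by simp
  next
    case False
    then have "({i. - i \<in> S}, - x, - y) \<in> products lamps C_steps (4 * n)"
      using xy S by (intro pos) force+
    from products_mirror[OF C_steps_mirror this] show ?thesis by simp
  qed
qed

section \<open>Tours\<close>

text \<open>The shortest walk on the integers that starts at \<open>0\<close>, covers \<open>{-m..n}\<close> and ends at a point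
  \<open>p\<close> of this interval has length \<open>2 * (m + n) - \<bar>p\<bar>\<close>.\<close>

definition tour_le :: "int set \<Rightarrow> int \<Rightarrow> int \<Rightarrow> bool" where
  "tour_le F p k \<longleftrightarrow>
     (\<exists>m n. 0 \<le> m \<and> 0 \<le> n \<and> - m \<le> p \<and> p \<le> n \<and> F \<subseteq> {- m..n} \<and> 2 * (m + n) - \<bar>p\<bar> \<le> k)"

lemma tour_le_empty: "tour_le {} 0 0"
  unfolding tour_le_def by (intro exI[of _ 0]) simp

text \<open>A straight walk to \<open>q\<close> is put in front of the old tour, which now starts at
  \<open>q\<close>.\<close>

lemma tour_le_move:
  assumes "tour_le F p k" and S: "S \<subseteq> seg q"
  shows "tour_le {i. (i \<in> S) \<noteq> (i - q \<in> F)} (q + p) (k + \<bar>q\<bar>)"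
proof -
  obtain m n where mn: "0 \<le> m" "0 \<le> n" "- m \<le> p" "p \<le> n" "F \<subseteq> {- m..n}"
    "2 * (m + n) - \<bar>p\<bar> \<le> k" using assms(1) unfolding tour_le_def by blast
  \<comment> \<open>The old interval shifted by \<open>q\<close>, enlarged where necessary to
    contain the new starting point \<open>0\<close>.\<close>
  define m' n' where "m' = max 0 (m - q)" and "n' = max 0 (n + q)"
  have "{i. (i \<in> S) \<noteq> (i - q \<in> F)} \<subseteq> {- m'..n'}"
  proof
    fix i assume "i \<in> {i. (i \<in> S) \<noteq> (i - q \<in> F)}"
    then have "i \<in> seg q \<or> i - q \<in> {- m..n}" using S mn(5) by auto
    then show "i \<in> {- m'..n'}" using mn(1-4) by (auto simp: seg_def m'_def n'_def)
  qed
  moreover have "0 \<le> m'" "0 \<le> n'" "- m' \<le> q + p" "q + p \<le> n'"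
    "2 * (m' + n') - \<bar>q + p\<bar> \<le> k + \<bar>q\<bar>"
    using mn(1-4,6) by (auto simp: m'_def n'_def max_def abs_if split: if_splits)
  ultimately show ?thesis unfolding tour_le_def by blast
qed

text \<open>The end point stays fixed and the interval grows by at most one place on one side, which
  costs a detour of length \<open>2\<close>.\<close>

lemma tour_le_toggle:
  assumes "tour_le F p k" and S: "S \<subseteq> {0, 1} \<or> S \<subseteq> {- 1, 0}"
  shows "tour_le {i. (i \<in> S) \<noteq> (i \<in> F)} p (k + 2)"
proof -
  obtain m n where mn: "0 \<le> m" "0 \<le> n" "- m \<le> p" "p \<le> n" "F \<subseteq> {- m..n}"
    "2 * (m + n) - \<bar>p\<bar> \<le> k" using assms(1) unfolding tour_le_def by blast
  define m' n' where "m' = (if S \<subseteq> {0, 1} then m else max m 1)"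
    and "n' = (if S \<subseteq> {0, 1} then max n 1 else n)"
  have "S \<subseteq> {- m'..n'}" using mn(1,2) S by (auto simp: m'_def n'_def)
  moreover have "{- m..n} \<subseteq> {- m'..n'}" by (auto simp: m'_def n'_def)
  ultimately have "S \<subseteq> {- m'..n'}" "F \<subseteq> {- m'..n'}" using mn(5) by blast+
  then have "{i. (i \<in> S) \<noteq> (i \<in> F)} \<subseteq> {- m'..n'}" by auto
  moreover have "0 \<le> m'" "0 \<le> n'" "- m' \<le> p" "p \<le> n'" "2 * (m' + n') - \<bar>p\<bar> \<le> k + 2"
    using mn by (auto simp: m'_def n'_def)
  ultimately show ?thesis unfolding tour_le_def by blast
qed

text \<open>Every factor moves the lamplighter by at most one place and toggles only lamps on its
  way, so it lengthens the tour by at most \<open>1\<close>. This is the lower bound for word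
  length.\<close>

lemma C_steps_tour:
  "(F, x, y) \<in> products lamps C_steps k \<Longrightarrow> tour_le F (x + y) (int k)"
proof (induction k arbitrary: F x y)
  case 0
  then show ?case by (simp add: lamps_one tour_le_empty)
next
  case (Suc k)
  then obtain S a b F' x' y' where s: "(S, a, b) \<in> C_steps"
    and g: "(F', x', y') \<in> products lamps C_steps k"
    and eq: "(F, x, y) = (S, a, b) \<otimes>\<^bsub>lamps\<^esub> (F', x', y')" by (auto simp: products.simps(2))
  have "tour_le F (a + b + (x' + y')) (int k + \<bar>a + b\<bar>)"
    using tour_le_move[OF Suc.IH[OF g], of S "a + b"] s eq by (simp add: C_steps_def lamps_mult)
  moreover have "\<bar>a + b\<bar> \<le> 1" "x + y = a + b + (x' + y')"
    using s eq by (auto simp: C_steps_def lamps_mult)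
  ultimately show ?case unfolding tour_le_def by force
qed

text \<open>A step from \<open>D_steps\<close> lengthens the tour by some \<open>j\<close> and changes \<open>x - y\<close> by at most \<open>2 - j\<close>.\<close>

lemma D_steps_tour:
  "(F, x, y) \<in> products lamps D_steps k \<Longrightarrow> tour_le F (x + y) (2 * int k - \<bar>x - y\<bar>)"
proof (induction k arbitrary: F x y)
  case 0
  then show ?case by (simp add: lamps_one tour_le_empty)
next
  case (Suc k)
  then obtain S a b F' x' y' where s: "(S, a, b) \<in> D_steps"
    and g: "(F', x', y') \<in> products lamps D_steps k"
    and eq: "(F, x, y) = (S, a, b) \<otimes>\<^bsub>lamps\<^esub> (F', x', y')" by (auto simp: products.simps(2))
  have xy: "x + y = a + b + (x' + y')" "x - y = a - b + (x' - y')"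
    using eq by (auto simp: lamps_mult)
  obtain j where "tour_le F (x + y) j" "j \<le> 2 * int (Suc k) - \<bar>x - y\<bar>"
  proof (cases "\<bar>a\<bar> \<le> 1 \<and> \<bar>b\<bar> \<le> 1 \<and> S \<subseteq> seg (a + b)")
    case True
    then have "tour_le F (x + y) (2 * int k - \<bar>x' - y'\<bar> + \<bar>a + b\<bar>)"
      using tour_le_move[OF Suc.IH[OF g], of S "a + b"] eq xy by (simp add: lamps_mult)
    \<comment> \<open>The sum equals twice the larger of \<open>\<bar>a\<bar>\<close> and
      \<open>\<bar>b\<bar>\<close>.\<close>
    moreover have "\<bar>a + b\<bar> + \<bar>a - b\<bar> \<le> 2" using True by linarith
    ultimately show ?thesis using that xy by force
  next
    case False
    then have "a = 0" "b = 0" "S \<subseteq> {0, 1} \<or> S \<subseteq> {- 1, 0}" using s by (auto simp: D_steps_def)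
    then have "tour_le F (x + y) (2 * int k - \<bar>x' - y'\<bar> + 2)"
      using tour_le_toggle[OF Suc.IH[OF g], of S] eq by (simp add: lamps_mult)
    then show ?thesis using that xy \<open>a = 0\<close> \<open>b = 0\<close> by force
  qed
  then show ?case unfolding tour_le_def by force
qed

text \<open>Limits how far a perturbation by \<open>k\<close> steps can reach; used for the elements
  near a deep dead end.\<close>

lemma C_steps_bounded:
  "(F, x, y) \<in> products lamps C_steps k \<Longrightarrow> F \<subseteq> {- int k..int k} \<and> \<bar>x\<bar> + \<bar>y\<bar> \<le> int k"
proof (induction k arbitrary: F x y)
  case 0
  then show ?case by (simp add: lamps_one)
next
  case (Suc k)
  then obtain S a b F' x' y' where s: "(S, a, b) \<in> C_steps"
    and g: "(F', x', y') \<in> products lamps C_steps k"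
    and eq: "(F, x, y) = (S, a, b) \<otimes>\<^bsub>lamps\<^esub> (F', x', y')" by (auto simp: products.simps(2))
  have ab: "\<bar>a\<bar> + \<bar>b\<bar> \<le> 1" "S \<subseteq> {- 1..1}" using s by (auto simp: C_steps_def seg_def subset_iff)
  have F': "F' \<subseteq> {- int k..int k}" "\<bar>x'\<bar> + \<bar>y'\<bar> \<le> int k" using Suc.IH[OF g] by auto
  have "F \<subseteq> {- int (Suc k)..int (Suc k)}"
  proof
    fix i assume "i \<in> F"
    then have "i \<in> {- 1..1} \<or> i - (a + b) \<in> {- int k..int k}"
      using eq ab(2) F'(1) by (auto simp: lamps_mult)
    then show "i \<in> {- int (Suc k)..int (Suc k)}" using ab(1) by auto
  qed
  then show ?case using eq F'(2) ab(1) by (auto simp: lamps_mult)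
qed

section \<open>Short words over the second generating set\<close>

text \<open>A round trip costs one step per place of its reach: a step \<open>t u\<close> goes out
  two places, the rest is done from there, and the step back toggles both lamps passed. For odd
  \<open>n\<close> the innermost lamp is toggled without moving.\<close>

lemma D_loop:
  "S \<subseteq> {1..int n} \<Longrightarrow> (S, 0, 0) \<in> products lamps D_steps n"
proof (induction n arbitrary: S rule: induct_nat_012)
  case 0
  then show ?case by (simp add: lamps_one)
next
  case 1
  then have "(S, 0, 0) \<in> D_steps" by (auto simp: D_steps_def)
  then show ?case using lamps.products_1[OF D_steps_closed] by simp
next
  case (ge2 n)
  let ?P = "products lamps D_steps"
  have 1: "({}, 1, 1) \<in> ?P 1"
    by (rule lamps.products_1[OF D_steps_closed]) (simp add: D_steps_def)
  have 2: "({i. 1 \<le> i \<and> i + 2 \<in> S}, 0, 0) \<in> ?P n" by (rule ge2.IH) (use ge2.prems in auto)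
  \<comment> \<open>Seen from place \<open>2\<close>, the lamps \<open>1\<close> and
    \<open>2\<close> lie at \<open>- 1\<close> and \<open>0\<close>.\<close>
  have 3: "({i. - 1 \<le> i \<and> i \<le> 0 \<and> i + 2 \<in> S}, - 1, - 1) \<in> ?P 1"
    by (rule lamps.products_1[OF D_steps_closed]) (auto simp: D_steps_def seg_def)
  have 12: "({i. 3 \<le> i \<and> i \<in> S}, 1, 1) \<in> ?P (Suc n)"
    by (rule lamps_products_mult[OF D_steps_closed 1 2]) auto
  have "S = {i. (i \<in> {i. 3 \<le> i \<and> i \<in> S}) \<noteq>
      (i - (1 + 1) \<in> {i. - 1 \<le> i \<and> i \<le> 0 \<and> i + 2 \<in> S})}"
    using ge2.prems by auto
  then show ?case by (rule lamps_products_mult[OF D_steps_closed 12 3]) simp_all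
qed

lemma D_loop_left:
  assumes "S \<subseteq> {- int n..- 1}"
  shows "(S, 0, 0) \<in> products lamps D_steps n"
proof -
  have "({i. - i \<in> S}, 0, 0) \<in> products lamps D_steps n" by (rule D_loop) (use assms in force)
  from products_mirror[OF D_steps_mirror this] show ?thesis by simp
qed

text \<open>Steps \<open>t u\<close> cover two places each, and an odd distance ends with a single
  \<open>t\<close>; this keeps the two exponents as equal as possible.\<close>

lemma D_leg:
  "\<lbrakk>S \<subseteq> {1..2 * int k + e}; e = 0 \<or> e = 1\<rbrakk> \<Longrightarrow>
   (S, int k + e, int k) \<in> products lamps D_steps (k + nat e)"
proof (induction k arbitrary: S)
  case 0
  show ?case
  proof (cases "e = 0")
    case True
    with 0 show ?thesis by (simp add: lamps_one)
  next
    case False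
    with 0 have "(S, e, 0) \<in> D_steps" by (auto simp: D_steps_def seg_def)
    then show ?thesis using lamps.products_1[OF D_steps_closed] 0 False by auto
  qed
next
  case (Suc k)
  let ?P = "products lamps D_steps"
  have 1: "(S \<inter> {1, 2}, 1, 1) \<in> ?P 1"
    by (rule lamps.products_1[OF D_steps_closed]) (auto simp: D_steps_def seg_def)
  have 2: "({i. 1 \<le> i \<and> i + 2 \<in> S}, int k + e, int k) \<in> ?P (k + nat e)"
    by (rule Suc.IH) (use Suc.prems in auto)
  have "S = {i. (i \<in> S \<inter> {1, 2}) \<noteq> (i - (1 + 1) \<in> {i. 1 \<le> i \<and> i + 2 \<in> S})}" (is "_ = ?R")
  proof (rule Set.set_eqI)
    fix i
    have "i \<in> S \<Longrightarrow> i \<ge> 1" using Suc.prems(1) by auto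
    then show "i \<in> S \<longleftrightarrow> i \<in> ?R" by (cases "i \<le> 2") auto
  qed
  then show ?case by (rule lamps_products_mult[OF D_steps_closed 1 2]) simp_all
qed

lemma D_drift: "({}, int j, - int j) \<in> products lamps D_steps j"
proof (induction j)
  case 0
  then show ?case by (simp add: lamps_one)
next
  case (Suc j)
  have "({}, 1, - 1) \<in> products lamps D_steps 1"
    by (rule lamps.products_1[OF D_steps_closed]) (simp add: D_steps_def)
  from lamps_products_mult[OF D_steps_closed this Suc] show ?case by simp
qed

text \<open>Lamp \<open>0\<close> is toggled first, then come a loop to the left, a leg to the end
  point \<open>p\<close>, a loop beyond \<open>p\<close>, and a drift by powers of
  \<open>t u\<inverse>\<close> that corrects the exponents. The separate step for lamp
  \<open>0\<close> accounts for the \<open>Suc\<close>.\<close>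

lemma D_steps_upper_aux:
  assumes S: "S \<subseteq> {- m..n}" and m: "0 \<le> m" and p: "0 \<le> x + y" "x + y \<le> n" and d: "x \<ge> y"
    and k: "2 * (m + n) - (x + y) + (x - y) \<le> 2 * int k"
  shows "(S, x, y) \<in> products lamps D_steps (Suc k)"
proof -
  let ?P = "products lamps D_steps"
  define p h e where "p = x + y" and "h = p div 2" and "e = p mod 2"
  have p2: "p = 2 * h + e" "e = 0 \<or> e = 1" "0 \<le> h" using p by (auto simp: p_def h_def e_def)
  \<comment> \<open>Since \<open>x \<ge> y\<close>, the exponent \<open>x\<close> is at least half
    of \<open>p\<close> rounded up, so the drift has the right sign.\<close>
  have j: "0 \<le> x - (h + e)" using p2 d by (auto simp: p_def)
  have 0: "(S \<inter> {0}, 0, 0) \<in> ?P 1"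
    by (rule lamps.products_1[OF D_steps_closed]) (auto simp: D_steps_def seg_def)
  have 1: "(S \<inter> {- m..- 1}, 0, 0) \<in> ?P (nat m)" by (rule D_loop_left) (use m in auto)
  have "(S \<inter> {1..p}, int (nat h) + e, int (nat h)) \<in> ?P (nat h + nat e)"
    by (rule D_leg) (use p2 in auto)
  then have 2: "(S \<inter> {1..p}, h + e, h) \<in> ?P (nat h + nat e)" using p2 by simp
  have 3: "({i. 1 \<le> i \<and> i + p \<in> S}, 0, 0) \<in> ?P (nat (n - p))"
    by (rule D_loop) (use S p in \<open>auto simp: p_def\<close>)
  have 4: "({}, x - (h + e), - (x - (h + e))) \<in> ?P (nat (x - (h + e)))"
    using D_drift[of "nat (x - (h + e))"] j by simp
  have 01: "(S \<inter> {- m..0}, 0, 0) \<in> ?P (1 + nat m)"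
    by (rule lamps_products_mult[OF D_steps_closed 0 1]) (use m in auto)
  have 012: "(S \<inter> {- m..p}, h + e, h) \<in> ?P (1 + nat m + (nat h + nat e))"
    by (rule lamps_products_mult[OF D_steps_closed 01 2]) (use m p in \<open>auto simp: p_def\<close>)
  have "S = {i. (i \<in> S \<inter> {- m..p}) \<noteq> (i - (h + e + h) \<in> {i. 1 \<le> i \<and> i + p \<in> S})}"
    using S p2 by auto
  then have 0123: "(S, h + e, h) \<in> ?P (1 + nat m + (nat h + nat e) + nat (n - p))"
    by (rule lamps_products_mult[OF D_steps_closed 012 3]) simp_all
  have "(S, x, y) \<in> ?P (1 + nat m + (nat h + nat e) + nat (n - p) + nat (x - (h + e)))"
    by (rule lamps_products_mult[OF D_steps_closed 0123 4]) (use p2 in \<open>auto simp: p_def\<close>)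
  \<comment> \<open>Apart from the step for lamp \<open>0\<close> the cost is
    \<open>m + n - y\<close>, half of the left-hand side of assumption \<open>k\<close>.\<close>
  moreover have "1 + nat m + (nat h + nat e) + nat (n - p) + nat (x - (h + e)) \<le> Suc k"
    using k p2 m p j by (auto simp: p_def)
  ultimately show ?thesis using lamps.products_mono[OF D_steps_closed one_in_D_steps] by blast
qed

text \<open>Together with \<open>D_steps_tour\<close> this determines word length up to an error of \<open>1\<close>.\<close>

lemma D_steps_upper:
  assumes "tour_le S (x + y) (2 * int k - \<bar>x - y\<bar>)"
  shows "(S, x, y) \<in> products lamps D_steps (Suc k)"
proof -
  have pos: "(S, x, y) \<in> products lamps D_steps (Suc k)"
    if "S \<subseteq> {- m..n}" "0 \<le> m" "0 \<le> x + y" "x + y \<le> n"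
      "2 * (m + n) - (x + y) + \<bar>x - y\<bar> \<le> 2 * int k" for S m n x y
  proof (cases "x \<ge> y")
    case True
    then show ?thesis using that by (intro D_steps_upper_aux[of S m n]) auto
  next
    case False
    then have "(S, y, x) \<in> products lamps D_steps (Suc k)"
      using that by (intro D_steps_upper_aux[of S m n]) auto
    then show ?thesis using products_swap D_steps_swap by blast
  qed
  obtain m n where mn: "0 \<le> m" "0 \<le> n" "- m \<le> x + y" "x + y \<le> n" "S \<subseteq> {- m..n}"
    "2 * (m + n) - \<bar>x + y\<bar> \<le> 2 * int k - \<bar>x - y\<bar>" using assms unfolding tour_le_def by blast
  show ?thesis
  proof (cases "x + y \<ge> 0")
    case True
    then show ?thesis using mn by (intro pos[of S m n]) auto
  next
    case False
    have "{i. - i \<in> S} \<subseteq> {- n..m}" using mn(5) by force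
    then have "({i. - i \<in> S}, - x, - y) \<in> products lamps D_steps (Suc k)"
      using mn False by (intro pos[of _ n m]) auto
    from products_mirror[OF D_steps_mirror this] show ?thesis by simp
  qed
qed

section \<open>Dead-end depth in the model\<close>

lemma C_steps_exhaust:
  assumes g: "g \<in> carrier lamps"
  shows "\<exists>k. g \<in> products lamps C_steps k"
proof -
  obtain F x y where Fxy: "g = (F, x, y)" by (cases g)
  \<comment> \<open>\<open>Max B\<close> bounds the exponents and all lit lamps; the entry
    \<open>1\<close> supplies the positive radius required by \<open>C_steps_upper\<close>.\<close>
  define B where "B = insert (nat (\<bar>x\<bar> + \<bar>y\<bar>)) (insert 1 ((nat \<circ> abs) ` F))"
  have "finite B" using g by (simp add: Fxy B_def)
  then have n: "k \<le> Max B" if "k \<in> B" for k using that by simp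
  have "F \<subseteq> {- int (Max B)..int (Max B)}"
  proof
    fix i assume "i \<in> F"
    then have "nat \<bar>i\<bar> \<le> Max B" by (intro n) (auto simp: B_def)
    then show "i \<in> {- int (Max B)..int (Max B)}" by auto
  qed
  moreover have "1 \<le> Max B" "nat (\<bar>x\<bar> + \<bar>y\<bar>) \<le> Max B" by (rule n; simp add: B_def)+
  ultimately have "g \<in> products lamps C_steps (4 * Max B)"
    unfolding Fxy by (intro C_steps_upper) auto
  then show ?thesis by blast
qed

lemma D_steps_exhaust: "g \<in> carrier lamps \<Longrightarrow> \<exists>k. g \<in> products lamps D_steps k"
  using C_steps_exhaust products_mono_set[OF C_steps_subset] by blast

lemma lamps_unbounded_depth:
  assumes S: "S \<subseteq> carrier lamps" "sym_set lamps S = C_steps"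
  shows "unbounded_depth lamps S"
  unfolding unbounded_depth_def
proof
  fix N
  note wl = lamps.word_length_le_iff[OF S(1), unfolded S(2), OF C_steps_exhaust]
  define n g where "n = int (Suc N)" and "g = ({- n, n}, 0 :: int, 0 :: int)"
  have g: "g \<in> carrier lamps" by (simp add: g_def)
  \<comment> \<open>A tour that covers \<open>- n\<close> and \<open>n\<close> and ends at
    \<open>0\<close> has length at least \<open>4 * n\<close>.\<close>
  have lower: "4 * Suc N \<le> word_length lamps S g"
  proof -
    have "g \<in> products lamps C_steps (word_length lamps S g)"
      using wl[OF g] order_refl by blast
    from C_steps_tour[OF this[unfolded g_def]]
    show ?thesis unfolding tour_le_def g_def n_def by auto
  qed
  have near: "word_length lamps S h \<le> word_length lamps S g"
    if h: "h \<in> carrier lamps" and d: "word_dist lamps S g h \<le> N" for h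
  proof -
    define s where "s = inv\<^bsub>lamps\<^esub> g \<otimes>\<^bsub>lamps\<^esub> h"
    obtain F x y where s': "s = (F, x, y)" by (cases s)
    have s: "s \<in> carrier lamps" "h = g \<otimes>\<^bsub>lamps\<^esub> s"
      unfolding s_def using g h by (simp_all add: lamps.m_assoc[symmetric])
    have "(F, x, y) \<in> products lamps C_steps N"
      using d wl[OF s(1)]
      unfolding word_dist_def s_def[symmetric] s' by blast
    \<comment> \<open>The position of \<open>g\<close> is \<open>0\<close>, so its product with
      \<open>s\<close> shifts no lamp of \<open>s\<close>; all lamps stay in
      \<open>{- n..n}\<close>, and the upper bound \<open>4 * n\<close> still applies.\<close>
    from C_steps_bounded[OF this]
    have "h \<in> products lamps C_steps (4 * Suc N)"
      unfolding s(2) s' g_def lamps_mult by (intro C_steps_upper) (auto simp: n_def)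
    then have "word_length lamps S h \<le> 4 * Suc N"
      using wl[OF h] by blast
    then show ?thesis using lower by simp
  qed
  have "enat (Suc N) \<le> dead_end_depth lamps S g"
    unfolding dead_end_depth_def
  proof (rule INF_greatest)
    fix h
    assume "h \<in> {h \<in> carrier lamps. word_dist lamps S \<one>\<^bsub>lamps\<^esub> g < word_dist lamps S \<one>\<^bsub>lamps\<^esub> h}"
    then have "h \<in> carrier lamps" "word_length lamps S g < word_length lamps S h"
      using g by (auto simp: lamps.word_dist_one)
    with near[of h] show "enat (Suc N) \<le> enat (word_dist lamps S g h)" by force
  qed
  then have "dead_end_depth lamps S g > enat N" by (rule less_le_trans[rotated]) simp
  with g show "\<exists>g\<in>carrier lamps. dead_end_depth lamps S g > enat N" by blast
qed

lemma lamps_depth_le_2: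
  assumes S: "S \<subseteq> carrier lamps" "sym_set lamps S = D_steps" and g: "g \<in> carrier lamps"
  shows "dead_end_depth lamps S g \<le> 2"
proof -
  note wl = lamps.word_length_le_iff[OF S(1), unfolded S(2), OF D_steps_exhaust]
  obtain F x y where Fxy: "g = (F, x, y)" by (cases g)
  \<comment> \<open>The sign for which multiplying by \<open>(t u\<inverse>)\<close> to the power
    \<open>2 * e\<close> moves \<open>x - y\<close> away from \<open>0\<close>.\<close>
  define e where "e = (if x \<ge> y then 1 else - 1 :: int)"
  define z h where "z = ({} :: int set, 2 * e, - 2 * e)" and "h = g \<otimes>\<^bsub>lamps\<^esub> z"
  have h': "h = (F, x + 2 * e, y - 2 * e)" by (simp add: h_def z_def Fxy lamps_mult)
  have z: "z \<in> carrier lamps" and h: "h \<in> carrier lamps" using g by (simp_all add: z_def h' Fxy)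
  have *: "({}, e, - e) \<in> products lamps D_steps 1"
    by (rule lamps.products_1[OF D_steps_closed]) (simp add: D_steps_def e_def)
  have z2: "z \<in> products lamps D_steps 2"
    unfolding z_def by (rule lamps_products_mult[OF D_steps_closed * *]) simp_all
  have "word_dist lamps S g h \<le> 2"
  proof -
    have "inv\<^bsub>lamps\<^esub> g \<otimes>\<^bsub>lamps\<^esub> h = z"
      unfolding h_def using g z by (simp add: lamps.m_assoc[symmetric])
    then show ?thesis
      using wl[OF z] z2 by (simp add: word_dist_def)
  qed
  moreover have "word_length lamps S g < word_length lamps S h"
  proof -
    define j where "j = word_length lamps S h"
    have "h \<in> products lamps D_steps j"
      unfolding j_def using wl[OF h] order_refl by blast
    note D_steps_tour[OF this[unfolded h']]
    moreover have "x + 2 * e + (y - 2 * e) = x + y"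
      "\<bar>x + 2 * e - (y - 2 * e)\<bar> = \<bar>x - y\<bar> + 4" by (auto simp: e_def)
    ultimately have tour: "tour_le F (x + y) (2 * int j - (\<bar>x - y\<bar> + 4))"
      by simp
    \<comment> \<open>Tour lengths are nonnegative, so the bound
      \<open>2 * int j - (\<bar>x - y\<bar> + 4)\<close> cannot be negative.\<close>
    then have "j \<ge> 2" unfolding tour_le_def by auto
    with tour have "tour_le F (x + y) (2 * int (j - 2) - \<bar>x - y\<bar>)"
      by (simp add: of_nat_diff algebra_simps)
    \<comment> \<open>The gain of \<open>2\<close> exceeds the error of \<open>1\<close>: the length
      of \<open>g\<close> is at most \<open>j - 1\<close>.\<close>
    from D_steps_upper[OF this] have "g \<in> products lamps D_steps (Suc (j - 2))" by (simp add: Fxy)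
    then have "word_length lamps S g \<le> Suc (j - 2)"
      using wl[OF g] by blast
    with \<open>j \<ge> 2\<close> show ?thesis unfolding j_def by simp
  qed
  ultimately have "dead_end_depth lamps S g \<le> enat (word_dist lamps S g h)"
    unfolding dead_end_depth_def using g h by (intro INF_lower) (simp add: lamps.word_dist_one)
  also have "\<dots> \<le> 2" using \<open>word_dist lamps S g h \<le> 2\<close> by (simp add: numeral_eq_enat)
  finally show ?thesis .
qed

section \<open>Normal forms\<close>

context group
begin

text \<open>Conjugation from the left, opposite to \<open>wconj\<close>: it composes as an action,
  and conjugating by \<open>t\<close> moves lamps in the positive direction.\<close>

definition conjg :: "'a \<Rightarrow> 'a \<Rightarrow> 'a" where "conjg x g = x \<otimes> g \<otimes> inv x"

lemma conjg_closed [simp]: "x \<in> carrier G \<Longrightarrow> g \<in> carrier G \<Longrightarrow> conjg x g \<in> carrier G"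
  by (simp add: conjg_def)

lemma inv_mult_cancel: "x \<in> carrier G \<Longrightarrow> g \<in> carrier G \<Longrightarrow> inv x \<otimes> (x \<otimes> g) = g"
  by (simp add: m_assoc[symmetric])

lemma mult_inv_cancel: "x \<in> carrier G \<Longrightarrow> g \<in> carrier G \<Longrightarrow> x \<otimes> (inv x \<otimes> g) = g"
  by (simp add: m_assoc[symmetric])

lemma conjg_mult: "\<lbrakk>x \<in> carrier G; g \<in> carrier G; h \<in> carrier G\<rbrakk> \<Longrightarrow>
    conjg x (g \<otimes> h) = conjg x g \<otimes> conjg x h"
  by (simp add: conjg_def m_assoc inv_mult_cancel)

lemma conjg_conjg: "\<lbrakk>x \<in> carrier G; y \<in> carrier G; g \<in> carrier G\<rbrakk> \<Longrightarrow>
    conjg x (conjg y g) = conjg (x \<otimes> y) g"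
  by (simp add: conjg_def m_assoc inv_mult_group)

lemma conjg_one: "g \<in> carrier G \<Longrightarrow> conjg \<one> g = g"
  by (simp add: conjg_def)

lemma conjg_swap: "\<lbrakk>x \<in> carrier G; g \<in> carrier G\<rbrakk> \<Longrightarrow> x \<otimes> g = conjg x g \<otimes> x"
  by (simp add: conjg_def m_assoc)

lemma group_commutes_int_pow:
  assumes "x \<otimes> y = y \<otimes> x" "x \<in> carrier G" "y \<in> carrier G"
  shows "x [^] (i::int) \<otimes> y = y \<otimes> x [^] i"
proof (cases i rule: int_cases)
  case (nonneg n)
  then show ?thesis using group_commutes_pow[OF assms] by (simp add: int_pow_int)
next
  case (neg n)
  have "x [^] Suc n \<otimes> y = y \<otimes> x [^] Suc n" by (rule group_commutes_pow[OF assms])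
  then have "inv (x [^] Suc n) \<otimes> y = y \<otimes> inv (x [^] Suc n)"
    using assms(2,3) by (metis inv_closed inv_solve_left inv_solve_right m_assoc m_closed nat_pow_closed)
  then show ?thesis unfolding neg int_pow_neg_int[OF assms(2)] .
qed

end

text \<open>The defining relations in a form suited to rewriting; because \<open>a\<close> is an
  involution, the third relator becomes the equality \<open>conj_u\<close> of two
  conjugates.\<close>

locale lamp_relations = group G for G (structure) +
  fixes a t u
  assumes closed [simp]: "a \<in> carrier G" "t \<in> carrier G" "u \<in> carrier G"
    and a_sq: "a \<otimes> a = \<one>"
    and tu: "t \<otimes> u = u \<otimes> t"
    and conj_u: "conjg (inv u) a = conjg (inv t) a"
    and comm: "a \<otimes> conjg (t [^] (i::int)) a = conjg (t [^] i) a \<otimes> a"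
begin

text \<open>The element that toggles the lamp at \<open>i\<close> and returns to the origin.\<close>

definition b :: "int \<Rightarrow> 'a" where "b i = conjg (t [^] i) a"

definition B :: "int list \<Rightarrow> 'a" where "B js = foldr (\<lambda>i g. b i \<otimes> g) js \<one>"

lemma b_closed [simp]: "b i \<in> carrier G"
  by (simp add: b_def)

lemma B_closed [simp]: "B js \<in> carrier G"
  by (induction js) (simp_all add: B_def)

lemma B_Nil: "B [] = \<one>" and B_Cons: "B (i # js) = b i \<otimes> B js"
  by (simp_all add: B_def)

lemma b_0: "b 0 = a"
  by (simp add: b_def conjg_one)

lemma conjg_t_b: "conjg (t [^] (j::int)) (b i) = b (j + i)"
  by (simp add: b_def conjg_conjg int_pow_mult)

lemma b_sq: "b i \<otimes> b i = \<one>"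
  by (simp add: b_def conjg_mult[symmetric] a_sq) (simp add: conjg_def)

text \<open>Conjugating the relation \<open>comm\<close> for the exponent \<open>j - i\<close> by
  \<open>t [^] i\<close> gives the general case.\<close>

lemma b_comm: "b i \<otimes> b j = b j \<otimes> b i"
proof -
  have "b i = conjg (t [^] i) a" "b j = conjg (t [^] i) (b (j - i))"
    by (simp_all add: conjg_t_b) (simp add: b_def)
  then show ?thesis using comm[of "j - i"] by (simp add: conjg_mult[symmetric] b_def)
qed

lemma b_cancel: "g \<in> carrier G \<Longrightarrow> b i \<otimes> (b i \<otimes> g) = g"
  by (simp add: m_assoc[symmetric] b_sq)

text \<open>After \<open>u\<close> slides past the power of \<open>t\<close>, \<open>conj_u\<close>
  turns the inner conjugate by \<open>inv t\<close> into one by \<open>inv u\<close>, which cancels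
  against \<open>u\<close>. So \<open>u\<close> shifts lamps exactly as \<open>t\<close>
  does.\<close>

lemma conjg_u_b: "conjg u (b i) = b (1 + i)"
proof -
  have "b i = conjg (t [^] (1 + i)) (conjg (inv t) a)"
    using conjg_t_b[of "1 + i" "- 1"] by (simp add: b_def int_pow_neg)
  then have "conjg u (b i) = conjg (u \<otimes> t [^] (1 + i)) (conjg (inv t) a)"
    by (simp add: conjg_conjg m_assoc)
  also have "u \<otimes> t [^] (1 + i) = t [^] (1 + i) \<otimes> u"
    using group_commutes_int_pow[OF tu] by simp
  also have "conjg (t [^] (1 + i) \<otimes> u) (conjg (inv t) a) =
      conjg (t [^] (1 + i)) (conjg u (conjg (inv u) a))"
    by (simp only: conj_u) (simp add: conjg_conjg m_assoc)
  also have "conjg u (conjg (inv u) a) = a" by (simp add: conjg_conjg conjg_one)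
  finally show ?thesis by (simp add: b_def)
qed

lemma conjg_inv_u_b: "conjg (inv u) (b i) = b (- 1 + i)"
  using conjg_u_b[of "- 1 + i", symmetric] by (simp add: conjg_conjg conjg_one)

lemma shift_B:
  assumes "x \<in> carrier G" "\<And>i. conjg x (b i) = b (c + i)"
  shows "x \<otimes> B js = B (map ((+) c) js) \<otimes> x"
proof (induction js)
  case Nil
  then show ?case using assms(1) by (simp add: B_Nil)
next
  case (Cons i js)
  have "x \<otimes> B (i # js) = conjg x (b i) \<otimes> (x \<otimes> B js)"
    using assms(1) by (simp add: B_Cons conjg_swap[of x "b i"] flip: m_assoc)
  then show ?case using assms Cons by (simp add: B_Cons m_assoc)
qed

text \<open>A lamp already in the list commutes to its occurrence and cancels there; any other is
  put in front.\<close>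

lemma b_B:
  assumes "distinct js"
  shows "\<exists>ks. distinct ks \<and> b i \<otimes> B js = B ks"
proof (cases "i \<in> set js")
  case False
  then show ?thesis using assms by (intro exI[of _ "i # js"]) (simp add: B_Cons)
next
  case True
  have "i \<in> set js \<Longrightarrow> b i \<otimes> B js = B (remove1 i js)" for js
  proof (induction js)
    case (Cons j js)
    show ?case
    proof (cases "i = j")
      case True
      then show ?thesis by (simp add: B_Cons b_cancel)
    next
      case False
      have "b i \<otimes> B (j # js) = b j \<otimes> (b i \<otimes> B js)"
        by (simp add: B_Cons b_comm[of i j] flip: m_assoc)
      with Cons False show ?thesis by (simp add: B_Cons)
    qed
  qed simp
  then show ?thesis using True assms by (intro exI[of _ "remove1 i js"]) simp
qed

text \<open>Distinctness makes the list an enumeration of the lit lamps, so that the model can read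
  off the set.\<close>

definition normal_forms :: "'a set" where
  "normal_forms = {B js \<otimes> (t [^] x \<otimes> u [^] y) | js (x::int) (y::int). distinct js}"

text \<open>Common argument for \<open>t\<close>, \<open>u\<close> and their inverses:
  \<open>x\<close> passes the lamps, shifting them by \<open>c\<close>, and is absorbed by the
  powers behind them.\<close>

lemma normal_forms_shift:
  fixes d e :: "int \<Rightarrow> int"
  assumes x: "x \<in> carrier G" "\<And>i. conjg x (b i) = b (c + i)"
    and xtu: "\<And>k l :: int. x \<otimes> (t [^] k \<otimes> u [^] l) = t [^] d k \<otimes> u [^] e l"
    and g: "g \<in> normal_forms"
  shows "x \<otimes> g \<in> normal_forms"
proof -
  obtain js k l where g: "g = B js \<otimes> (t [^] (k::int) \<otimes> u [^] (l::int))" "distinct js"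
    using g unfolding normal_forms_def by blast
  have "x \<otimes> g = B (map ((+) c) js) \<otimes> (x \<otimes> (t [^] k \<otimes> u [^] l))"
    using x(1) shift_B[OF x] by (simp add: g flip: m_assoc)
  then have "x \<otimes> g = B (map ((+) c) js) \<otimes> (t [^] d k \<otimes> u [^] e l)" by (simp only: xtu)
  moreover have "distinct (map ((+) c) js)" using g(2) by (simp add: distinct_map)
  ultimately show ?thesis unfolding normal_forms_def mem_Collect_eq by blast
qed

lemma inv_a: "inv a = a"
  by (rule inv_equality) (simp_all add: a_sq)

lemma normal_forms_mult:
  assumes g: "g \<in> normal_forms" and x: "x \<in> {a, t, u} \<union> m_inv G ` {a, t, u}"
  shows "x \<otimes> g \<in> normal_forms"
proof -
  have comm: "u [^] i \<otimes> t [^] j = t [^] j \<otimes> u [^] i" for i j :: int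
    using group_commutes_int_pow[OF group_commutes_int_pow[OF tu, of j, symmetric], of i] by simp
  have t: "t [^] i \<otimes> (t [^] k \<otimes> u [^] l) = t [^] (i + k) \<otimes> u [^] l" for i k l :: int
    by (simp add: int_pow_mult m_assoc)
  have u: "u [^] i \<otimes> (t [^] k \<otimes> u [^] l) = t [^] k \<otimes> u [^] (i + l)" for i k l :: int
    by (simp add: int_pow_mult comm flip: m_assoc)
  consider "x = a" | "x = t" | "x = inv t" | "x = u" | "x = inv u" using x inv_a by auto
  then show ?thesis
  proof cases
    case 1
    obtain js k l where g: "g = B js \<otimes> (t [^] (k::int) \<otimes> u [^] (l::int))" "distinct js"
      using g unfolding normal_forms_def by blast
    obtain ks where "distinct ks" "b 0 \<otimes> B js = B ks" using b_B[OF g(2)] by blast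
    then have "a \<otimes> g = B ks \<otimes> (t [^] k \<otimes> u [^] l)" using g(1) by (simp add: b_0 flip: m_assoc)
    then show ?thesis using \<open>distinct ks\<close> 1 unfolding normal_forms_def by blast
  next
    case 2
    then show ?thesis
      using conjg_t_b[of 1] t[of 1] g by (intro normal_forms_shift[of x 1 "\<lambda>k. 1 + k" "\<lambda>l. l"]) simp_all
  next
    case 3
    then show ?thesis
      using conjg_t_b[of "- 1"] t[of "- 1"] g
      by (intro normal_forms_shift[of x "- 1" "\<lambda>k. - 1 + k" "\<lambda>l. l"]) (simp_all add: int_pow_neg)
  next
    case 4
    then show ?thesis
      using conjg_u_b u[of 1] g by (intro normal_forms_shift[of x 1 "\<lambda>k. k" "\<lambda>l. 1 + l"]) simp_all
  next
    case 5
    then show ?thesis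
      using conjg_inv_u_b u[of "- 1"] g
      by (intro normal_forms_shift[of x "- 1" "\<lambda>k. k" "\<lambda>l. - 1 + l"]) (simp_all add: int_pow_neg)
  qed
qed

lemma one_in_normal_forms: "\<one> \<in> normal_forms"
  unfolding normal_forms_def by (intro CollectI exI[of _ "[]"] exI[of _ 0]) (simp add: B_Nil)

end

section \<open>The relations and normal forms in the presented group\<close>

lemma (in group) commutator_one_imp_commute:
  assumes "inv x \<otimes> inv y \<otimes> x \<otimes> y = \<one>" and [simp]: "x \<in> carrier G" "y \<in> carrier G"
  shows "x \<otimes> y = y \<otimes> x"
proof -
  have "y \<otimes> x = (y \<otimes> x) \<otimes> (inv x \<otimes> inv y \<otimes> x \<otimes> y)" using assms(1) by simp
  also have "\<dots> = x \<otimes> y" by (simp add: m_assoc mult_inv_cancel)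
  finally show ?thesis by simp
qed

lemma pres_class_winv:
  "pres_class R (winv w) = inv\<^bsub>presented_group R\<^esub> pres_class R w"
proof -
  interpret group "presented_group R" by (rule group_presented_group)
  have closed: "pres_class R v \<in> carrier (presented_group R)" for v
    unfolding presented_group_carrier by (rule rangeI)
  have "pres_class R (winv w) \<otimes>\<^bsub>presented_group R\<^esub> pres_class R w = \<one>\<^bsub>presented_group R\<^esub>"
    unfolding presented_group_mult presented_group_one pres_class_eq_iff by (rule pres_eq_winv)
  then show ?thesis by (rule inv_equality[symmetric]) (rule closed)+
qed

lemma pres_class_wpow:
  "pres_class R (wpow w i) = pres_class R w [^]\<^bsub>presented_group R\<^esub> i"
proof -
  interpret group "presented_group R" by (rule group_presented_group)
  have nat: "pres_class R (concat (replicate n w)) = pres_class R w [^]\<^bsub>presented_group R\<^esub> n" for n w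
  proof (induction n)
    case 0
    then show ?case by (simp add: presented_group_one)
  next
    case (Suc n)
    have "pres_class R w [^]\<^bsub>presented_group R\<^esub> Suc n =
        pres_class R w \<otimes>\<^bsub>presented_group R\<^esub> pres_class R w [^]\<^bsub>presented_group R\<^esub> n"
      by (rule nat_pow_Suc2) (simp add: presented_group_carrier)
    then show ?case by (simp add: presented_group_mult Suc[symmetric])
  qed
  have "pres_class R w \<in> carrier (presented_group R)" by (simp add: presented_group_carrier)
  note inv = nat_pow_inv[OF this]
  show ?thesis
  proof (cases "0 \<le> i")
    case True
    then have "wpow w i = concat (replicate (nat i) w)" by (simp add: wpow_def)
    then show ?thesis using True by (simp only: nat int_pow_def2 linorder_not_less[symmetric] if_not_P not_not if_False)
  next
    case False
    then have "wpow w i = concat (replicate (nat (- i)) (winv w))" by (simp add: wpow_def)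
    then show ?thesis using False by (simp only: nat int_pow_def2 pres_class_winv inv not_le if_True)
  qed
qed

lemma pres_class_relator:
  "r \<in> R \<Longrightarrow> pres_class R r = \<one>\<^bsub>presented_group R\<^esub>"
  using pres_eq.relator[of r R "[]" "[]"] by (simp add: presented_group_one pres_class_eq_iff)

abbreviation "H_class \<equiv> pres_class H_relators"

interpretation H: group H
  unfolding H_def by (rule group_presented_group)

lemma H_class_closed [simp]: "H_class w \<in> carrier H"
  by (simp add: H_def presented_group_carrier)

lemma H_class_append: "H_class (v @ w) = H_class v \<otimes>\<^bsub>H\<^esub> H_class w"
  by (simp add: H_def presented_group_mult)

lemma H_class_winv: "H_class (winv w) = inv\<^bsub>H\<^esub> H_class w"
  by (simp add: H_def pres_class_winv)

lemma H_class_wpow: "H_class (wpow w i) = H_class w [^]\<^bsub>H\<^esub> i"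
  by (simp add: H_def pres_class_wpow)

lemma H_class_relator: "r \<in> H_relators \<Longrightarrow> H_class r = \<one>\<^bsub>H\<^esub>"
  unfolding H_def by (rule pres_class_relator)

lemma H_relatorsI:
  "wpow wa 2 \<in> H_relators" "wcomm wt wu \<in> H_relators"
  "wconj (winv wa) wu @ wconj wa wt \<in> H_relators"
  "wcomm wa (wconj wa (wpow wt i)) \<in> H_relators"
  by (auto simp: H_relators_def)

interpretation H: lamp_relations H "H_class wa" "H_class wt" "H_class wu"
proof
  let ?a = "H_class wa" and ?t = "H_class wt" and ?u = "H_class wu"
  have "wpow wa 2 = wa @ wa" by (simp add: wpow_def numeral_2_eq_2)
  then show a_sq: "?a \<otimes>\<^bsub>H\<^esub> ?a = \<one>\<^bsub>H\<^esub>"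
    using H_class_relator[OF H_relatorsI(1)] by (simp add: H_class_append)
  from H_class_relator[OF H_relatorsI(2)] show "?t \<otimes>\<^bsub>H\<^esub> ?u = ?u \<otimes>\<^bsub>H\<^esub> ?t"
    by (intro H.commutator_one_imp_commute) (simp_all add: wcomm_def H_class_append H_class_winv H.m_assoc)
  show "?a \<otimes>\<^bsub>H\<^esub> H.conjg (?t [^]\<^bsub>H\<^esub> i) ?a = H.conjg (?t [^]\<^bsub>H\<^esub> i) ?a \<otimes>\<^bsub>H\<^esub> ?a" for i :: int
  proof -
    \<comment> \<open>The sign is reversed because \<open>wconj\<close> conjugates from the other
      side than \<open>conjg\<close>.\<close>
    note H_class_relator[OF H_relatorsI(4), of "- i"]
    moreover have "H_class (wconj wa (wpow wt (- i))) = H.conjg (?t [^]\<^bsub>H\<^esub> i) ?a"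
      by (simp add: wconj_def H_class_append H_class_winv H_class_wpow H.conjg_def H.int_pow_neg H.m_assoc)
    ultimately show ?thesis
      by (intro H.commutator_one_imp_commute)
        (simp_all add: wcomm_def H_class_append H_class_winv H.m_assoc)
  qed
  note H_class_relator[OF H_relatorsI(3)]
  moreover have "inv\<^bsub>H\<^esub> ?a = ?a" by (rule H.inv_equality) (simp_all add: a_sq)
  ultimately have "H.conjg (inv\<^bsub>H\<^esub> ?u) ?a \<otimes>\<^bsub>H\<^esub> H.conjg (inv\<^bsub>H\<^esub> ?t) ?a = \<one>\<^bsub>H\<^esub>"
    by (simp add: wconj_def H_class_append H_class_winv H.conjg_def H.m_assoc)
  \<comment> \<open>The conjugate by \<open>inv t\<close> is an involution, and the relator makes
    the conjugate by \<open>inv u\<close> its inverse as well; hence the two agree.\<close>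
  moreover have "H.conjg (inv\<^bsub>H\<^esub> ?t) ?a \<otimes>\<^bsub>H\<^esub> H.conjg (inv\<^bsub>H\<^esub> ?t) ?a = \<one>\<^bsub>H\<^esub>"
    by (simp add: H.conjg_mult[symmetric] a_sq) (simp add: H.conjg_def)
  ultimately show "H.conjg (inv\<^bsub>H\<^esub> ?u) ?a = H.conjg (inv\<^bsub>H\<^esub> ?t) ?a"
    using H.inv_equality[of "H.conjg (inv\<^bsub>H\<^esub> ?u) ?a" "H.conjg (inv\<^bsub>H\<^esub> ?t) ?a"]
      H.inv_equality[of "H.conjg (inv\<^bsub>H\<^esub> ?t) ?a" "H.conjg (inv\<^bsub>H\<^esub> ?t) ?a"] by simp
qed simp_all

lemma H_carrier: "carrier H = range H_class"
  by (simp add: H_def presented_group_carrier)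

lemma H_class_Cons:
  "\<exists>x \<in> {H_class wa, H_class wt, H_class wu} \<union> m_inv H ` {H_class wa, H_class wt, H_class wu}.
     H_class (l # w) = x \<otimes>\<^bsub>H\<^esub> H_class w"
proof -
  obtain g p where l: "l = (g, p)" by (cases l)
  have "H_class (l # w) = H_class [l] \<otimes>\<^bsub>H\<^esub> H_class w" using H_class_append[of "[l]" w] by simp
  moreover have "[l] \<in> {wa, wt, wu} \<union> winv ` {wa, wt, wu}"
    by (cases g; cases p) (simp_all add: l wa_def wt_def wu_def winv_def)
  ultimately show ?thesis by (auto simp: H_class_winv)
qed

text \<open>Words grow on the left by letters, and each letter preserves the set of normal
  forms.\<close>

lemma H_normal_forms: "carrier H \<subseteq> H.normal_forms"
proof -
  have "H_class w \<in> H.normal_forms" for w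
  proof (induction w)
    case Nil
    then show ?case using H.one_in_normal_forms by (simp add: H_def presented_group_one)
  next
    case (Cons l w)
    then show ?case using H_class_Cons[of l w] H.normal_forms_mult by metis
  qed
  then show ?thesis by (auto simp: H_carrier)
qed

lemma H_generate:
  assumes "{H_class wa, H_class wt, H_class wu} \<subseteq> S" "S \<subseteq> carrier H"
  shows "generate H S = carrier H"
proof
  show "generate H S \<subseteq> carrier H" using assms(2) by (rule H.generate_incl)
  have "H_class w \<in> generate H S" for w
  proof (induction w)
    case Nil
    then show ?case using generate.one[of H S] by (simp add: H_def presented_group_one)
  next
    case (Cons l w)
    obtain x where x: "x \<in> {H_class wa, H_class wt, H_class wu} \<union> m_inv H ` {H_class wa, H_class wt, H_class wu}"
      "H_class (l # w) = x \<otimes>\<^bsub>H\<^esub> H_class w" by (rule bexE[OF H_class_Cons[of l w]])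
    from x(1) assms(1) have "x \<in> S \<union> m_inv H ` S" by blast
    then have "x \<in> generate H S" by (auto intro: generate.incl generate.inv)
    then show ?case unfolding x(2) using Cons by (rule generate.eng)
  qed
  then show "carrier H \<subseteq> generate H S" by (auto simp: H_carrier)
qed

section \<open>Identification of the group with the model\<close>

text \<open>The sign of a letter \<open>A\<close> is ignored because toggling a lamp is its own
  inverse.\<close>

fun letter_val :: "gen \<times> bool \<Rightarrow> int set \<times> int \<times> int" where
  "letter_val (A, p) = ({0}, 0, 0)"
| "letter_val (T, p) = ({}, if p then 1 else - 1, 0)"
| "letter_val (U, p) = ({}, 0, if p then 1 else - 1)"

definition eval_word :: "gen word \<Rightarrow> int set \<times> int \<times> int" where
  "eval_word w = foldr (\<lambda>l. (\<otimes>\<^bsub>lamps\<^esub>) (letter_val l)) w \<one>\<^bsub>lamps\<^esub>"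

lemma letter_val_closed [simp]: "letter_val l \<in> carrier lamps"
  by (cases l rule: letter_val.cases) auto

lemma eval_word_simps: "eval_word [] = \<one>\<^bsub>lamps\<^esub>"
    "eval_word (l # w) = letter_val l \<otimes>\<^bsub>lamps\<^esub> eval_word w"
  by (simp_all add: eval_word_def)

lemma eval_word_closed [simp]: "eval_word w \<in> carrier lamps"
  by (induction w) (simp_all add: eval_word_simps)

lemma eval_word_append: "eval_word (v @ w) = eval_word v \<otimes>\<^bsub>lamps\<^esub> eval_word w"
  by (induction v) (simp_all add: eval_word_simps lamps.m_assoc)

lemma letter_val_inv: "letter_val (x, p) \<otimes>\<^bsub>lamps\<^esub> letter_val (x, \<not> p) = \<one>\<^bsub>lamps\<^esub>"
  by (cases x; cases p) (simp_all add: lamps_mult lamps_one)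

lemma eval_word_winv: "eval_word (winv w) = inv\<^bsub>lamps\<^esub> eval_word w"
proof (induction w)
  case Nil
  then show ?case by (simp add: eval_word_simps winv_def)
next
  case (Cons l w)
  obtain x p where l: "l = (x, p)" by (cases l)
  have "inv\<^bsub>lamps\<^esub> letter_val l = letter_val (x, \<not> p)"
    unfolding l using letter_val_inv[of x "\<not> p"] by (intro lamps.inv_equality) simp_all
  moreover have "winv (l # w) = winv w @ [(x, \<not> p)]" by (simp add: winv_def l)
  ultimately show ?case
    by (simp add: eval_word_append eval_word_simps lamps.inv_mult_group Cons)
qed

lemma eval_word_gens:
  "eval_word wa = ({0}, 0, 0)" "eval_word wt = ({}, 1, 0)" "eval_word wu = ({}, 0, 1)"
  by (simp_all add: wa_def wt_def wu_def eval_word_simps lamps_mult lamps_one)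

lemma eval_word_wpow: "eval_word (wpow wt i) = ({}, i, 0)" "eval_word (wpow wu i) = ({}, 0, i)"
proof -
  have "eval_word (replicate n (T, p)) = ({}, if p then int n else - int n, 0)"
    "eval_word (replicate n (U, p)) = ({}, 0, if p then int n else - int n)" for n p
    by (induction n) (auto simp: eval_word_simps lamps_mult lamps_one)
  moreover have "concat (replicate n [l]) = replicate n l" for n and l :: "gen \<times> bool"
    by (induction n) simp_all
  ultimately show "eval_word (wpow wt i) = ({}, i, 0)" "eval_word (wpow wu i) = ({}, 0, i)"
    by (auto simp: wpow_def wt_def wu_def winv_def)
qed

lemma eval_word_relator:
  assumes "r \<in> H_relators"
  shows "eval_word r = \<one>\<^bsub>lamps\<^esub>"
proof -
  have "wpow wa 2 = wa @ wa" by (simp add: wpow_def numeral_2_eq_2)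
  then have "eval_word (wpow wa 2) = \<one>\<^bsub>lamps\<^esub>"
    by (simp add: eval_word_append eval_word_gens lamps_mult lamps_one)
  moreover have "eval_word (wcomm wt wu) = \<one>\<^bsub>lamps\<^esub>"
    by (simp add: wcomm_def eval_word_append eval_word_winv eval_word_gens lamps_inv lamps_mult lamps_one)
  moreover have "eval_word (wconj (winv wa) wu @ wconj wa wt) = \<one>\<^bsub>lamps\<^esub>"
    by (simp add: wconj_def eval_word_append eval_word_winv eval_word_gens lamps_inv lamps_mult lamps_one)
  moreover have "eval_word (wcomm wa (wconj wa (wpow wt i))) = \<one>\<^bsub>lamps\<^esub>" for i
  proof -
    have "eval_word (wconj wa (wpow wt i)) = ({- i}, 0, 0)"
      by (auto simp: wconj_def eval_word_append eval_word_winv eval_word_gens eval_word_wpow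
          lamps_inv lamps_mult)
    then show ?thesis
      by (auto simp: wcomm_def eval_word_append eval_word_winv eval_word_gens lamps_inv lamps_mult lamps_one)
  qed
  ultimately show ?thesis using assms by (auto simp: H_relators_def)
qed

lemma eval_word_cong: "pres_eq H_relators v w \<Longrightarrow> eval_word v = eval_word w"
proof (induction rule: pres_eq.induct)
  case (cancel v x p w)
  have "letter_val (x, p) \<otimes>\<^bsub>lamps\<^esub> (letter_val (x, \<not> p) \<otimes>\<^bsub>lamps\<^esub> eval_word w) = eval_word w"
    by (simp add: letter_val_inv flip: lamps.m_assoc)
  then show ?case by (simp add: eval_word_append eval_word_simps)
next
  case (relator r v w)
  then show ?case by (simp add: eval_word_append eval_word_relator)
qed simp_all

text \<open>\<open>the_elem\<close> is justified because all words of a class have the same value in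
  the model.\<close>

definition eval_class :: "gen word set \<Rightarrow> int set \<times> int \<times> int" where
  "eval_class X = the_elem (eval_word ` X)"

lemma eval_class [simp]: "eval_class (H_class w) = eval_word w"
proof -
  have mem: "v \<in> H_class w \<longleftrightarrow> pres_eq H_relators w v" for v
    by (simp add: pres_class_def pres_rel_def)
  have "eval_word v = eval_word w" if "v \<in> H_class w" for v
    using that eval_word_cong[of w v] by (simp add: mem)
  moreover have "w \<in> H_class w" by (simp add: mem pres_eq.refl)
  ultimately have "eval_word ` H_class w = {eval_word w}" by blast
  then show ?thesis by (simp add: eval_class_def)
qed

interpretation eval: group_hom H lamps eval_class
  by unfold_locales (auto simp: hom_def H_carrier eval_word_append simp flip: H_class_append)

lemma eval_class_pow:
  "eval_class (H_class wt [^]\<^bsub>H\<^esub> (i::int)) = ({}, i, 0)"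
  "eval_class (H_class wu [^]\<^bsub>H\<^esub> (i::int)) = ({}, 0, i)"
  by (simp_all only: eval_word_wpow eval_class flip: H_class_wpow)

lemma eval_class_B: "distinct js \<Longrightarrow> eval_class (H.B js) = (set js, 0, 0)"
proof (induction js)
  case Nil
  then show ?case by (simp add: H.B_Nil lamps_one)
next
  case (Cons j js)
  have "eval_class (H.b j) = ({j}, 0, 0)"
    by (auto simp: H.b_def H.conjg_def eval_class_pow eval_word_gens lamps_inv lamps_mult)
  with Cons show ?case by (auto simp: H.B_Cons lamps_mult)
qed

lemma eval_class_normal_form:
  "distinct js \<Longrightarrow> eval_class (H.B js \<otimes>\<^bsub>H\<^esub>
     (H_class wt [^]\<^bsub>H\<^esub> (x::int) \<otimes>\<^bsub>H\<^esub> H_class wu [^]\<^bsub>H\<^esub> (y::int))) = (set js, x, y)"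
  by (simp add: eval_class_B eval_class_pow lamps_mult)

text \<open>The value of a normal form displays its lamps and exponents: enumerating a finite set
  gives surjectivity, and a trivial value forces the empty list and zero exponents.\<close>

lemma eval_class_iso: "eval_class \<in> iso H lamps"
  unfolding eval.iso_iff
proof (intro conjI ballI impI subsetI)
  fix g assume "g \<in> carrier lamps"
  moreover obtain F x y where g: "g = (F, x, y)" by (cases g)
  ultimately obtain js where "set js = F" "distinct js" using finite_distinct_list[of F] by auto
  then show "g \<in> eval_class ` carrier H"
    unfolding g using eval_class_normal_form[of js x y] by (metis H.B_closed H.int_pow_closed
      H.m_closed H_class_closed imageI)
next
  fix g assume "g \<in> carrier H" "eval_class g = \<one>\<^bsub>lamps\<^esub>"
  moreover from this(1) obtain js and x y :: int where
    g: "g = H.B js \<otimes>\<^bsub>H\<^esub> (H_class wt [^]\<^bsub>H\<^esub> x \<otimes>\<^bsub>H\<^esub> H_class wu [^]\<^bsub>H\<^esub> y)" "distinct js"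
    using H_normal_forms unfolding H.normal_forms_def by blast
  ultimately have "js = []" "x = 0" "y = 0"
    using eval_class_normal_form[of js x y] by (simp_all add: lamps_one)
  then show "g = \<one>\<^bsub>H\<^esub>" by (simp add: g H.B_Nil)
qed

lemmas eval_simps = eval_word_append eval_word_winv eval_word_gens lamps_inv lamps_mult

section \<open>The generators in the model\<close>

text \<open>Listed in the same order as the words in \<open>C_gens\<close>.\<close>

definition C_vals :: "(int set \<times> int \<times> int) set" where
  "C_vals = {({0}, 0, 0), ({}, 1, 0), ({}, 0, 1), ({0}, 1, 0), ({1}, 1, 0), ({0, 1}, 1, 0),
     ({0}, 0, 1), ({1}, 0, 1), ({0, 1}, 0, 1)}"

definition D_vals :: "(int set \<times> int \<times> int) set" where
  "D_vals = C_vals \<union> {({}, 1, 1), ({0}, 1, 1), ({1}, 1, 1), ({2}, 1, 1), ({0, 1}, 1, 1),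
     ({0, 2}, 1, 1), ({1, 2}, 1, 1), ({0, 1, 2}, 1, 1), ({}, - 1, 1), ({0}, - 1, 1),
     ({1}, 0, 0), ({- 1}, 0, 0), ({0, 1}, 0, 0), ({0, - 1}, 0, 0)}"

lemma eval_C_gens: "eval_class ` C_gens = C_vals"
proof -
  have "eval_class ` C_gens = eval_word ` {wa, wt, wu, wa @ wt, wt @ wa, wa @ wt @ wa,
      wa @ wu, wu @ wa, wa @ wu @ wa}"
    unfolding C_gens_def image_image eval_class ..
  moreover have "eval_word (wa @ wt) = ({0}, 1, 0)" "eval_word (wt @ wa) = ({1}, 1, 0)"
    "eval_word (wa @ wt @ wa) = ({0, 1}, 1, 0)"
    "eval_word (wa @ wu) = ({0}, 0, 1)" "eval_word (wu @ wa) = ({1}, 0, 1)"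
    "eval_word (wa @ wu @ wa) = ({0, 1}, 0, 1)"
    by (auto simp: eval_simps)
  ultimately show ?thesis by (simp add: C_vals_def eval_word_gens)
qed

lemma eval_D_gens: "eval_class ` D_gens = D_vals"
proof -
  have "eval_class ` D_gens = C_vals \<union> eval_word ` {wt @ wu, wa @ wt @ wu, wt @ wa @ wu,
      wt @ wu @ wa, wa @ wt @ wa @ wu, wa @ wt @ wu @ wa,
      wt @ wa @ wu @ wa, wa @ wt @ wa @ wu @ wa, wu @ winv wt,
      wa @ wu @ winv wt, wt @ wa @ winv wt, winv wt @ wa @ wt,
      wa @ wt @ wa @ winv wt, wa @ winv wt @ wa @ wt}"
    unfolding D_gens_def image_Un eval_C_gens image_image eval_class ..
  moreover have "eval_word (wt @ wu) = ({}, 1, 1)" "eval_word (wa @ wt @ wu) = ({0}, 1, 1)"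
    "eval_word (wt @ wa @ wu) = ({1}, 1, 1)" "eval_word (wt @ wu @ wa) = ({2}, 1, 1)"
    "eval_word (wa @ wt @ wa @ wu) = ({0, 1}, 1, 1)"
    "eval_word (wa @ wt @ wu @ wa) = ({0, 2}, 1, 1)"
    "eval_word (wt @ wa @ wu @ wa) = ({1, 2}, 1, 1)"
    "eval_word (wa @ wt @ wa @ wu @ wa) = ({0, 1, 2}, 1, 1)"
    "eval_word (wu @ winv wt) = ({}, - 1, 1)" "eval_word (wa @ wu @ winv wt) = ({0}, - 1, 1)"
    "eval_word (wt @ wa @ winv wt) = ({1}, 0, 0)" "eval_word (winv wt @ wa @ wt) = ({- 1}, 0, 0)"
    "eval_word (wa @ wt @ wa @ winv wt) = ({0, 1}, 0, 0)"
    "eval_word (wa @ winv wt @ wa @ wt) = ({0, - 1}, 0, 0)"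
    by (auto simp: eval_simps)
  ultimately show ?thesis by (simp add: D_vals_def)
qed


lemma seg_numerals: "seg 0 = {0}" "seg 1 = {0, 1}" "seg 2 = {0, 1, 2}"
  by (auto simp: seg_def)

text \<open>The inverse of a step walks the same segment backwards, with the lamps now seen from its
  far end.\<close>

lemma seg_shift: "F \<subseteq> seg (x + y) \<Longrightarrow> {i. i + (x + y) \<in> F} \<subseteq> seg (- y - x)"
proof
  fix i assume "F \<subseteq> seg (x + y)" "i \<in> {i. i + (x + y) \<in> F}"
  then have "i + (x + y) \<in> seg (x + y)" by blast
  then show "i \<in> seg (- y - x)" by (auto simp: seg_def min_def max_def split: if_splits)
qed

lemma C_steps_inv: "g \<in> C_steps \<Longrightarrow> inv\<^bsub>lamps\<^esub> g \<in> C_steps"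
proof -
  assume g: "g \<in> C_steps"
  obtain F x y where Fxy: "g = (F, x, y)" by (cases g)
  have "finite F" using g C_steps_closed Fxy by auto
  then show ?thesis using g seg_shift[of F x y] by (simp add: Fxy lamps_inv C_steps_def)
qed

lemma D_steps_inv: "g \<in> D_steps \<Longrightarrow> inv\<^bsub>lamps\<^esub> g \<in> D_steps"
proof -
  assume g: "g \<in> D_steps"
  obtain F x y where Fxy: "g = (F, x, y)" by (cases g)
  have "finite F" using g D_steps_closed Fxy by auto
  then have inv: "inv\<^bsub>lamps\<^esub> g = ({i. i + (x + y) \<in> F}, - x, - y)" by (simp add: Fxy lamps_inv)
  show ?thesis
  proof (cases "\<bar>x\<bar> \<le> 1 \<and> \<bar>y\<bar> \<le> 1 \<and> F \<subseteq> seg (x + y)")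
    case True
    then show ?thesis using seg_shift[of F x y] by (simp add: inv D_steps_def)
  next
    case False
    \<comment> \<open>An element without displacement only toggles lamps, so it is its own
      inverse.\<close>
    then have "x = 0" "y = 0" using g by (auto simp: Fxy D_steps_def)
    then have "inv\<^bsub>lamps\<^esub> g = g" using inv Fxy by simp
    then show ?thesis using g by simp
  qed
qed

text \<open>Inversion negates both exponents, and the five listed pairs together with their
  negatives are all pairs from \<open>{- 1, 0, 1}\<close>. So only elements with a listed pair have
  to be found in \<open>S\<close>.\<close>

lemma sym_set_eqI:
  assumes S: "S \<subseteq> X" and X: "X \<subseteq> carrier lamps" "\<one>\<^bsub>lamps\<^esub> \<in> X"
    and inv: "\<And>g. g \<in> X \<Longrightarrow> inv\<^bsub>lamps\<^esub> g \<in> X"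
    and bound: "\<And>F x y. (F, x, y) \<in> X \<Longrightarrow> \<bar>x\<bar> \<le> 1 \<and> \<bar>y\<bar> \<le> 1"
    and pos: "\<And>F x y. (F, x, y) \<in> X \<Longrightarrow> (x, y) \<in> {(0, 0), (1, 0), (0, 1), (1, 1), (- 1, 1)} \<Longrightarrow>
      (F, x, y) \<in> insert ({}, 0, 0) S"
  shows "sym_set lamps S = X"
proof
  show "sym_set lamps S \<subseteq> X" using S X(2) inv by (auto simp: sym_set_def)
  show "X \<subseteq> sym_set lamps S"
  proof
    fix g assume g: "g \<in> X"
    obtain F x y where Fxy: "g = (F, x, y)" by (cases g)
    have F: "finite F" using g X(1) Fxy by auto
    have "x \<in> {- 1, 0, 1}" "y \<in> {- 1, 0, 1}" using bound[of F x y] g Fxy by auto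
    then consider "(x, y) \<in> {(0, 0), (1, 0), (0, 1), (1, 1), (- 1, 1)}"
      | "(- x, - y) \<in> {(0, 0), (1, 0), (0, 1), (1, 1), (- 1, 1)}" by auto
    then show "g \<in> sym_set lamps S"
    proof cases
      case 1
      then show ?thesis using pos g unfolding Fxy sym_set_def lamps_one by blast
    next
      case 2
      then have "inv\<^bsub>lamps\<^esub> g \<in> insert \<one>\<^bsub>lamps\<^esub> S"
        using inv[OF g] F unfolding Fxy lamps_one by (simp only: lamps_inv pos)
      moreover have "g = inv\<^bsub>lamps\<^esub> (inv\<^bsub>lamps\<^esub> g)" using g X(1) by auto
      ultimately show ?thesis
        unfolding sym_set_def by (metis UnI1 UnI2 imageI insert_iff lamps.inv_one)
    qed
  qed
qed

lemma sym_set_C_vals: "sym_set lamps C_vals = C_steps"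
proof (rule sym_set_eqI[OF _ C_steps_closed one_in_C_steps C_steps_inv])
  show "C_vals \<subseteq> C_steps" by (simp add: C_vals_def C_steps_def seg_numerals)
next
  show "\<bar>x\<bar> \<le> 1 \<and> \<bar>y\<bar> \<le> 1" if "(F, x, y) \<in> C_steps" for F x y
    using that by (auto simp: C_steps_def)
next
  fix F x y
  assume g: "(F, x, y) \<in> C_steps" and xy: "(x, y) \<in> {(0, 0), (1, 0), (0, 1), (1, 1), (- 1, 1)}"
  \<comment> \<open>Membership in \<open>Pow\<close> lets the simplifier enumerate the finitely many
    subsets as explicit cases.\<close>
  have F: "F \<in> Pow (seg (x + y))" "\<bar>x\<bar> + \<bar>y\<bar> \<le> 1" using g by (simp_all add: C_steps_def)
  then consider "x = 0" "y = 0" | "x = 1" "y = 0" | "x = 0" "y = 1" using xy F(2) by auto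
  then show "(F, x, y) \<in> insert ({}, 0, 0) C_vals"
    by cases (use F(1) in \<open>simp_all only: add_0 add_0_right seg_numerals Pow_insert Pow_empty,
      auto simp: C_vals_def\<close>)
qed simp

lemma sym_set_D_vals: "sym_set lamps D_vals = D_steps"
proof (rule sym_set_eqI[OF _ D_steps_closed one_in_D_steps D_steps_inv])
  have "C_vals \<subseteq> D_steps" using sym_set_C_vals C_steps_subset by (auto simp: sym_set_def)
  then show "D_vals \<subseteq> D_steps" by (simp add: D_vals_def D_steps_def seg_numerals)
next
  show "\<bar>x\<bar> \<le> 1 \<and> \<bar>y\<bar> \<le> 1" if "(F, x, y) \<in> D_steps" for F x y
    using that by (auto simp: D_steps_def)
next
  fix F x y
  assume xy: "(x, y) \<in> {(0, 0), (1, 0), (0, 1), (1, 1), (- 1, 1)}"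
    and "(F, x, y) \<in> D_steps"
  then have F: "F \<in> Pow (seg (x + y)) \<or> (x = 0 \<and> y = 0 \<and> F \<in> Pow {0, 1} \<union> Pow {0, - 1})"
    unfolding D_steps_def by blast
  from xy consider "x = 0" "y = 0" | "x = 1" "y = 0" | "x = 0" "y = 1" | "x = - 1" "y = 1"
    | "x = 1" "y = 1" by auto
  then have "(x = 0 \<and> y = 0 \<and> F \<in> Pow (seg 0) \<union> Pow {0, 1} \<union> Pow {0, - 1}) \<or>
      (x = 1 \<and> y = 0 \<and> F \<in> Pow (seg 1)) \<or> (x = 0 \<and> y = 1 \<and> F \<in> Pow (seg 1)) \<or>
      (x = - 1 \<and> y = 1 \<and> F \<in> Pow (seg 0)) \<or> (x = 1 \<and> y = 1 \<and> F \<in> Pow (seg 2))"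
    by cases (use F in simp_all)
  then show "(F, x, y) \<in> insert ({}, 0, 0) D_vals"
    by (elim disjE conjE)
      (simp_all only: seg_numerals Pow_insert Pow_empty, auto simp: D_vals_def C_vals_def)
qed simp

theorem theorem3:
  shows "finite C_gens \<and> generate H C_gens = carrier H \<and> unbounded_depth H C_gens \<and>
         finite D_gens \<and> generate H D_gens = carrier H \<and>
         (\<forall>g\<in>carrier H. dead_end_depth H D_gens g \<le> 2)"
proof (intro conjI ballI)
  show "finite C_gens" "finite D_gens" by (simp_all add: C_gens_def D_gens_def)
  have C: "C_gens \<subseteq> carrier H" unfolding C_gens_def by auto
  then have D: "D_gens \<subseteq> carrier H" unfolding D_gens_def by auto
  have gens: "{H_class wa, H_class wt, H_class wu} \<subseteq> C_gens" by (simp add: C_gens_def)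
  show "generate H C_gens = carrier H" by (rule H_generate[OF gens C])
  have "{H_class wa, H_class wt, H_class wu} \<subseteq> D_gens" using gens by (auto simp: D_gens_def)
  then show "generate H D_gens = carrier H" using D by (rule H_generate)
  \<comment> \<open>Both depth claims are transported to the model, where the generators become
    \<open>C_vals\<close> and \<open>D_vals\<close>.\<close>
  note depth = dead_end_depth_iso[OF eval_class_iso H.is_group group_lamps]
  have C': "C_vals \<subseteq> carrier lamps" and D': "D_vals \<subseteq> carrier lamps"
    by (auto simp: C_vals_def D_vals_def)
  show "unbounded_depth H C_gens"
    unfolding unbounded_depth_def
  proof
    fix N
    obtain g where g: "g \<in> carrier lamps" "enat N < dead_end_depth lamps C_vals g"
      using lamps_unbounded_depth[OF C' sym_set_C_vals] unfolding unbounded_depth_def by blast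
    then obtain h where h: "h \<in> carrier H" "g = eval_class h"
      using eval_class_iso by (auto simp: iso_def bij_betw_def)
    have "enat N < dead_end_depth H C_gens h"
      using g(2) depth[OF C h(1)] by (simp add: eval_C_gens h(2))
    with h(1) show "\<exists>g\<in>carrier H. enat N < dead_end_depth H C_gens g" by blast
  qed
  fix g assume g: "g \<in> carrier H"
  show "dead_end_depth H D_gens g \<le> 2"
    using lamps_depth_le_2[OF D' sym_set_D_vals eval.hom_closed[OF g]] depth[OF D g]
    by (simp add: eval_D_gens)
qed

end
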